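(* If $H$ is a chordal/tree decomposable constraint graph, then $\mathrm{Hom}(\mathcal{G},H)$ has the unique maximal configuration (UMC) property with distance $|H|-2$, for any board $\mathcal{G}$.
   Context: Graphs are undirected; $u\sim v$ denotes adjacency. A board is a countable, simple (loopless), connected, locally finite graph $\mathcal{G}=(\mathcal{V},\mathcal{E})$ with at least two vertices. A constraint graph is a finite graph $H=(V,E)$, loops allowed; $|H|=|V|$. $\mathrm{Hom}(\mathcal{G},H)$ is the set of graph homomorphisms $\omega:\mathcal{V}\to V$ (points). $\mathrm{dist}$ is graph distance in $\mathcal{G}$, and $\mathrm{N}_n(A)=\{x\in\mathcal{V}:\mathrm{dist}(x,A)\le n\}$ (with $\mathrm{dist}(x,\emptyset)=\infty$). $\Sigma_B(\alpha_1,\alpha_2)=\{x\in B:\alpha_1(x)\ne\alpha_2(x)\}$. For finite $A\subseteq\mathcal{V}$, $\mathcal{L}_A=\{\omega|_A:\omega\in\mathrm{Hom}(\mathcal{G},H)\}$, and $[\alpha]=\{\omega\in\mathrm{Hom}(\mathcal{G},H):\omega|_A=\alpha\}$ for $\alpha\in\mathcal{L}_A$. Unique maximal configuration (UMC) property with distance $g\in\mathbb{N}$: there exists a linear order $\prec$ on $V$ such that, writing $\omega\preccurlyeq\omega'$ if for every $x$ either $\omega(x)\prec\omega'(x)$ or $\omega(x)=\omega'(x)$, for every finite $A\subseteq\mathcal{V}$: (M1) for every $\alpha\in\mathcal{L}_A$ there is a unique point $\omega_\alpha\in[\alpha]$ such that $\omega\preccurlyeq\omega_\alpha$ for every point $\omega\in[\alpha]$;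 (M2) for any two $\alpha_1,\alpha_2\in\mathcal{L}_A$, $\Sigma_{\mathcal{V}}(\omega_{\alpha_1},\omega_{\alpha_2})\subseteq \mathrm{N}_g(\Sigma_A(\alpha_1,\alpha_2))$. Chordal/tree decomposable: $H[A]$ denotes the subgraph induced by $A\subseteq V$, and $E[A_1:A_2]$ the set of edges with one end in $A_1$ and the other in $A_2$, for disjoint $A_1,A_2\subseteq V$. A finite simple graph is chordal if all cycles of four or more vertices have a chord, i.e. an edge that is not part of the cycle but connects two vertices of the cycle. A finite graph is loop-chordal if every vertex has a loop and the simple graph obtained by deleting all loops is chordal. A tree is a connected graph with no cycles (a loop counts as a cycle). $H=(V,E)$ is chordal/tree decomposable if one can write $V=C\sqcup T\sqcup J$ (where $T$ and $J$ may be empty) such that: (1) $H[C]$ is a nonempty loop-chordal graph; (2) $T=T_1\sqcup\cdots\sqcup T_m$ and, for every $1\le j\le m$, $H[T_j]$ is a tree such that there exist unique vertices $r_j\in T_j$ and $c^j\in C$ such that $\{r_j,c^j\}\in E$; (3) $J=J_1\sqcup\cdots\sqcup J_n$ and, for every $1\le k\le n$, $H[J_k]$ is a connected graph such that there exists a unique vertex $c^k\in C$ such that $\{u,c^k\}\in E$ for every $u\in J_k$; (4) $E[T:J]=E[T_{j_1}:T_{j_2}]=E[J_{k_1}:J_{k_2}]=\emptyset$ for every $j_1\ne j_2$ and $k_1\neq k_2$.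
   Formalization: H is additionally assumed connected (for two isolated looped vertices the claim fails, and no disconnected H satisfies it for all boards); condition (3) is read as: c^k is the only neighbour in C of each u in J_k (asking only for a unique common neighbour makes the claim false). *)

theory Defs
  imports
    "HOL-Library.FuncSet"
    "HOL-Library.Countable_Set"
    "HOL-Library.Disjoint_Sets"
    "HOL-Library.Extended_Nat"
begin

section \<open>Undirected graphs\<close>

text \<open>An edge is the set of its ends, so a loop at \<open>v\<close> is the edge \<open>{v}\<close> (that is, \<open>{v, v}\<close>);
  there are no multiple edges.\<close>

record 'a ugraph =
  verts :: "'a set"
  edges :: "'a set set"

definition wf_ugraph :: "'a ugraph \<Rightarrow> bool" where
  "wf_ugraph G \<longleftrightarrow> (\<forall>e\<in>edges G. \<exists>u\<in>verts G. \<exists>v\<in>verts G. e = {u, v})"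

definition adj :: "'a ugraph \<Rightarrow> 'a \<Rightarrow> 'a \<Rightarrow> bool" where
  "adj G u v \<longleftrightarrow> {u, v} \<in> edges G"

definition loopless :: "'a ugraph \<Rightarrow> bool" where
  "loopless G \<longleftrightarrow> (\<forall>v. \<not> adj G v v)"

definition delete_loops :: "'a ugraph \<Rightarrow> 'a ugraph" where
  "delete_loops G = \<lparr>verts = verts G, edges = {e \<in> edges G. \<forall>v. e \<noteq> {v}}\<rparr>"

definition induced :: "'a ugraph \<Rightarrow> 'a set \<Rightarrow> 'a ugraph" where
  "induced G A = \<lparr>verts = verts G \<inter> A, edges = {e \<in> edges G. e \<subseteq> A}\<rparr>"

definition edges_between :: "'a ugraph \<Rightarrow> 'a set \<Rightarrow> 'a set \<Rightarrow> 'a set set" where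
  "edges_between G A B = {e \<in> edges G. \<exists>u\<in>A. \<exists>v\<in>B. e = {u, v}}"

definition walk_between :: "'a ugraph \<Rightarrow> 'a \<Rightarrow> 'a list \<Rightarrow> 'a \<Rightarrow> bool" where
  "walk_between G u p v \<longleftrightarrow>
     p \<noteq> [] \<and> set p \<subseteq> verts G \<and> successively (adj G) p \<and> hd p = u \<and> last p = v"

definition connected_ugraph :: "'a ugraph \<Rightarrow> bool" where
  "connected_ugraph G \<longleftrightarrow>
     verts G \<noteq> {} \<and> (\<forall>u\<in>verts G. \<forall>v\<in>verts G. \<exists>p. walk_between G u p v)"

definition locally_finite :: "'a ugraph \<Rightarrow> bool" where
  "locally_finite G \<longleftrightarrow> (\<forall>v\<in>verts G. finite {u. adj G v u})"

text \<open>Cycles are lists of distinct vertices, read cyclically. Length 1 gives exactly the loops;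
  length 2 is excluded since it would traverse a single edge twice.\<close>

definition is_cycle :: "'a ugraph \<Rightarrow> 'a list \<Rightarrow> bool" where
  "is_cycle G p \<longleftrightarrow>
     distinct p \<and> set p \<subseteq> verts G \<and> (length p = 1 \<or> length p \<ge> 3) \<and>
     (\<forall>i<length p. adj G (p ! i) (p ! (Suc i mod length p)))"

definition cycle_edges :: "'a list \<Rightarrow> 'a set set" where
  "cycle_edges p = {{p ! i, p ! (Suc i mod length p)} | i. i < length p}"

definition has_chord :: "'a ugraph \<Rightarrow> 'a list \<Rightarrow> bool" where
  "has_chord G p \<longleftrightarrow>
     (\<exists>u\<in>set p. \<exists>v\<in>set p. u \<noteq> v \<and> {u, v} \<in> edges G \<and> {u, v} \<notin> cycle_edges p)"

definition chordal :: "'a ugraph \<Rightarrow> bool" where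
  "chordal G \<longleftrightarrow> (\<forall>p. is_cycle G p \<and> length p \<ge> 4 \<longrightarrow> has_chord G p)"

definition loop_chordal :: "'a ugraph \<Rightarrow> bool" where
  "loop_chordal G \<longleftrightarrow>
     finite (verts G) \<and> (\<forall>v\<in>verts G. adj G v v) \<and> chordal (delete_loops G)"

definition is_tree :: "'a ugraph \<Rightarrow> bool" where
  "is_tree G \<longleftrightarrow> connected_ugraph G \<and> (\<nexists>p. is_cycle G p)"


section \<open>Boards, constraint graphs and homomorphisms\<close>

definition board :: "'v ugraph \<Rightarrow> bool" where
  "board G \<longleftrightarrow>
     wf_ugraph G \<and> countable (verts G) \<and> loopless G \<and> connected_ugraph G \<and> locally_finite G \<and>
     (\<exists>x\<in>verts G. \<exists>y\<in>verts G. x \<noteq> y)"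

definition constraint_graph :: "'h ugraph \<Rightarrow> bool" where
  "constraint_graph H \<longleftrightarrow> wf_ugraph H \<and> finite (verts H)"

definition Hom :: "'v ugraph \<Rightarrow> 'h ugraph \<Rightarrow> ('v \<Rightarrow> 'h) set" where
  "Hom G H = {\<omega> \<in> verts G \<rightarrow>\<^sub>E verts H. \<forall>x y. adj G x y \<longrightarrow> adj H (\<omega> x) (\<omega> y)}"

text \<open>Infima are taken in \<^typ>\<open>enat\<close>, where the infimum of the empty set is \<open>\<infinity>\<close>; in particular
  the distance to the empty set is \<open>\<infinity>\<close>.\<close>

definition graph_dist :: "'v ugraph \<Rightarrow> 'v \<Rightarrow> 'v \<Rightarrow> enat" where
  "graph_dist G x y = (INF p\<in>{p. walk_between G x p y}. enat (length p - 1))"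

definition dist_to_set :: "'v ugraph \<Rightarrow> 'v \<Rightarrow> 'v set \<Rightarrow> enat" where
  "dist_to_set G x A = (INF y\<in>A. graph_dist G x y)"

definition nbhd :: "'v ugraph \<Rightarrow> nat \<Rightarrow> 'v set \<Rightarrow> 'v set" where
  "nbhd G n A = {x \<in> verts G. dist_to_set G x A \<le> enat n}"

definition disagreement :: "'v set \<Rightarrow> ('v \<Rightarrow> 'h) \<Rightarrow> ('v \<Rightarrow> 'h) \<Rightarrow> 'v set" where
  "disagreement B \<alpha>1 \<alpha>2 = {x \<in> B. \<alpha>1 x \<noteq> \<alpha>2 x}"

definition language :: "'v ugraph \<Rightarrow> 'h ugraph \<Rightarrow> 'v set \<Rightarrow> ('v \<Rightarrow> 'h) set" where
  "language G H A = (\<lambda>\<omega>. restrict \<omega> A) ` Hom G H"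

definition cylinder :: "'v ugraph \<Rightarrow> 'h ugraph \<Rightarrow> 'v set \<Rightarrow> ('v \<Rightarrow> 'h) \<Rightarrow> ('v \<Rightarrow> 'h) set" where
  "cylinder G H A \<alpha> = {\<omega> \<in> Hom G H. restrict \<omega> A = \<alpha>}"


section \<open>The unique maximal configuration property\<close>

definition config_le :: "'v ugraph \<Rightarrow> 'h rel \<Rightarrow> ('v \<Rightarrow> 'h) \<Rightarrow> ('v \<Rightarrow> 'h) \<Rightarrow> bool" where
  "config_le G r \<omega> \<omega>' \<longleftrightarrow> (\<forall>x\<in>verts G. (\<omega> x, \<omega>' x) \<in> r \<or> \<omega> x = \<omega>' x)"

definition max_config ::
    "'v ugraph \<Rightarrow> 'h ugraph \<Rightarrow> 'h rel \<Rightarrow> 'v set \<Rightarrow> ('v \<Rightarrow> 'h) \<Rightarrow> ('v \<Rightarrow> 'h) \<Rightarrow> bool" where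
  "max_config G H r A \<alpha> \<omega>m \<longleftrightarrow>
     \<omega>m \<in> cylinder G H A \<alpha> \<and> (\<forall>\<omega>\<in>cylinder G H A \<alpha>. config_le G r \<omega> \<omega>m)"

text \<open>The second conjunct speaks about all maximal configurations of the two cylinders; by the
  first one these are the points \<open>\<omega>\<^bsub>\<alpha>1\<^esub>\<close> and \<open>\<omega>\<^bsub>\<alpha>2\<^esub>\<close>.\<close>

definition UMC :: "'v ugraph \<Rightarrow> 'h ugraph \<Rightarrow> nat \<Rightarrow> bool" where
  "UMC G H g \<longleftrightarrow>
     (\<exists>r. strict_linear_order_on (verts H) r \<and>
       (\<forall>A. finite A \<and> A \<subseteq> verts G \<longrightarrow>
         (\<forall>\<alpha>\<in>language G H A. \<exists>!\<omega>m. max_config G H r A \<alpha> \<omega>m) \<and>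
         (\<forall>\<alpha>1\<in>language G H A. \<forall>\<alpha>2\<in>language G H A. \<forall>\<omega>1 \<omega>2.
            max_config G H r A \<alpha>1 \<omega>1 \<and> max_config G H r A \<alpha>2 \<omega>2 \<longrightarrow>
            disagreement (verts G) \<omega>1 \<omega>2 \<subseteq> nbhd G g (disagreement A \<alpha>1 \<alpha>2))))"


section \<open>Chordal/tree decomposable graphs\<close>

text \<open>The attachment condition on a part \<open>Js k\<close> says that one and the same vertex \<open>c\<close> is, for every
  \<open>u \<in> Js k\<close>, the unique vertex of \<open>C\<close> adjacent to \<open>u\<close>. Requiring only that a unique \<open>c \<in> C\<close> is
  adjacent to all of \<open>Js k\<close> would leave individual vertices of \<open>Js k\<close> free to have further
  neighbours in \<open>C\<close>, and the unique maximal configuration property can then fail.\<close>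

definition chordal_tree_decomposable :: "'h ugraph \<Rightarrow> bool" where
  "chordal_tree_decomposable H \<longleftrightarrow>
     (\<exists>C T J (m::nat) (n::nat) Ts Js.
        verts H = C \<union> T \<union> J \<and> C \<inter> T = {} \<and> C \<inter> J = {} \<and> T \<inter> J = {} \<and>
        C \<noteq> {} \<and> loop_chordal (induced H C) \<and>
        T = (\<Union>j\<in>{1..m}. Ts j) \<and> disjoint_family_on Ts {1..m} \<and>
        (\<forall>j\<in>{1..m}. is_tree (induced H (Ts j)) \<and>
           (\<exists>!(t, c). t \<in> Ts j \<and> c \<in> C \<and> {t, c} \<in> edges H)) \<and>
        J = (\<Union>k\<in>{1..n}. Js k) \<and> disjoint_family_on Js {1..n} \<and>
        (\<forall>k\<in>{1..n}. connected_ugraph (induced H (Js k)) \<and>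
           (\<exists>!c. c \<in> C \<and> (\<forall>u\<in>Js k. \<forall>c'\<in>C. {u, c'} \<in> edges H \<longleftrightarrow> c' = c))) \<and>
        edges_between H T J = {} \<and>
        (\<forall>i\<in>{1..m}. \<forall>j\<in>{1..m}. i \<noteq> j \<longrightarrow> edges_between H (Ts i) (Ts j) = {}) \<and>
        (\<forall>k\<in>{1..n}. \<forall>l\<in>{1..n}. k \<noteq> l \<longrightarrow> edges_between H (Js k) (Js l) = {}))"

end

theory Submission
  imports Defs
begin

text \<open>
  Two configurations in the same cylinder need not have a pointwise maximum that is a
  homomorphism, even when the colours are ordered by successively removing vertices of \<open>H\<close>. What
  such an order does allow is to \<^emph>\<open>raise\<close> configurations. Call an injective key
  \<open>\<kappa>\<close> on the colours an elimination key if the following holds for every colour \<open>v\<close> and every set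
  \<open>F\<close> of smaller neighbours of \<open>v\<close>: as soon as some colour above \<open>v\<close> is adjacent to all of \<open>F\<close>,
  there is one that, in addition, is adjacent to all neighbours of \<open>v\<close> that are not below \<open>v\<close>.
  At a site coloured \<open>v\<close>, let \<open>F\<close> be the set of small colours around it. The condition then says
  that the colour of the site can be raised without touching any other site whenever the small
  colours around it leave room for this; moreover all sites of colour \<open>v\<close> with that room
  can be raised at the same time (\<open>raise_colour_class\<close>).

  Order the colours by an elimination key. Given two configurations in a cylinder, go through the
  colours from below. If they agree wherever one of them is below \<open>v\<close>, then at
  a site where exactly one of them is \<open>v\<close> the other one witnesses the required room, so the first
  can be raised there. In the end both have been raised to a common upper bound, that is, a
  cylinder is directed (\<open>cylinder_directed\<close>). Since adjacency only concerns two sites at a time, the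
  pointwise largest values of a directed cylinder form a homomorphism, which is the maximal
  configuration; the infinite board needs no compactness argument. Next let two maximal
  configurations differ at \<open>x\<close>, with smaller colour \<open>v\<close>, where the two boundary conditions do not
  differ. Then some neighbour of \<open>x\<close> also carries a disagreement, with a smaller colour
  than \<open>v\<close>: otherwise the configuration with \<open>v\<close> at \<open>x\<close> could be raised at \<open>x\<close>.
  Following such neighbours leads to a disagreement of the boundary conditions within as many steps
  as there are colours below \<open>v\<close> (\<open>max_config_disagreement\<close>). As \<open>v\<close> and a larger colour are not
  among them, these are at most \<open>|H| - 2\<close>.

  It remains to find an elimination key. A connected chordal graph has a perfect elimination
  order ending in a prescribed vertex, in which every other vertex has a later neighbour
  (\<open>chordal_rooted_perfect_key\<close>). Trees are chordal, and in a tree, which has no triangles, the later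
  neighbour is unique: it is the parent. Put \<open>J\<close> lowest, then the trees one after the other,
  each in an order ending in its root, and on top \<open>C\<close> in a perfect elimination order. Then a
  vertex of \<open>J\<^sub>k\<close> can be raised to \<open>c\<^sup>k\<close>, a tree vertex to its grandparent, where \<open>c\<^sup>j\<close> counts as
  parent of \<open>r\<^sub>j\<close> and as its own parent, and a vertex of \<open>C\<close> to any later neighbour
  (\<open>elimination_key_exists\<close>).
\<close>

section \<open>Adjacency and walks\<close>

lemma adj_commute: "adj G u v \<longleftrightarrow> adj G v u"
  by (simp add: adj_def insert_commute)

lemma wf_ugraph_adj_verts:
  assumes "wf_ugraph G" "adj G u v"
  shows "u \<in> verts G" "v \<in> verts G"
  using assms unfolding wf_ugraph_def adj_def by (metis insert_iff doubleton_eq_iff)+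

definition link :: "'a ugraph \<Rightarrow> 'a set \<Rightarrow> 'a \<Rightarrow> 'a \<Rightarrow> bool" where
  "link G W a b \<longleftrightarrow> a \<in> W \<and> b \<in> W \<and> adj G a b"

definition connected_in :: "'a ugraph \<Rightarrow> 'a set \<Rightarrow> bool" where
  "connected_in G W \<longleftrightarrow> (\<forall>u\<in>W. \<forall>v\<in>W. (link G W)\<^sup>*\<^sup>* u v)"

lemma walk_imp_link_rtranclp:
  assumes "successively (adj G) p" "set p \<subseteq> W" "p \<noteq> []"
  shows "(link G W)\<^sup>*\<^sup>* (hd p) (last p)"
  using assms
proof (induction p)
  case (Cons a p)
  show ?case
  proof (cases p)
    case (Cons b q)
    then have "link G W a b"
      using Cons.prems by (auto simp: link_def)
    moreover have "(link G W)\<^sup>*\<^sup>* b (last p)"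
      using Cons.IH Cons.prems Cons by auto
    ultimately show ?thesis
      using Cons by auto
  qed auto
qed simp

lemma link_rtranclp_imp_walk:
  assumes "(link G W)\<^sup>*\<^sup>* u v" "u \<in> W"
  shows "\<exists>p. p \<noteq> [] \<and> set p \<subseteq> W \<and> successively (adj G) p \<and> hd p = u \<and> last p = v"
  using assms
proof (induction rule: converse_rtranclp_induct)
  case base
  then show ?case by (intro exI[of _ "[v]"]) auto
next
  case (step y z)
  then obtain p where p: "p \<noteq> []" "set p \<subseteq> W" "successively (adj G) p" "hd p = z" "last p = v"
    by (auto simp: link_def)
  then show ?case
    using step(1) by (intro exI[of _ "y # p"]) (auto simp: link_def successively_Cons)
qed

lemma connected_ugraph_imp_connected_in:
  assumes "connected_ugraph G"
  shows "connected_in G (verts G)"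
  unfolding connected_in_def
proof (intro ballI)
  fix u v assume "u \<in> verts G" "v \<in> verts G"
  then obtain p where "walk_between G u p v"
    using assms by (auto simp: connected_ugraph_def)
  then show "(link G (verts G))\<^sup>*\<^sup>* u v"
    using walk_imp_link_rtranclp[of G p "verts G"] by (auto simp: walk_between_def)
qed

text \<open>Retractions transport walks. The lemma serves both to delete a simplicial vertex, which is
  folded onto a neighbour, and to contract the parts of a decomposition onto its chordal core.\<close>

lemma connected_in_retract:
  assumes conn: "connected_in G W"
    and sub: "W' \<subseteq> W"
    and into: "\<And>a. a \<in> W \<Longrightarrow> f a \<in> W'"
    and fixed: "\<And>a. a \<in> W' \<Longrightarrow> f a = a"
    and edge: "\<And>a b. a \<in> W \<Longrightarrow> b \<in> W \<Longrightarrow> adj G a b \<Longrightarrow> f a = f b \<or> adj G' (f a) (f b)"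
  shows "connected_in G' W'"
  unfolding connected_in_def
proof (intro ballI)
  fix u v assume uv: "u \<in> W'" "v \<in> W'"
  then have "(link G W)\<^sup>*\<^sup>* u v"
    using conn sub by (auto simp: connected_in_def)
  then have "(link G' W')\<^sup>*\<^sup>* (f u) (f v)"
  proof (induction rule: rtranclp_induct)
    case (step y z)
    then have "f y = f z \<or> link G' W' (f y) (f z)"
      using into edge by (auto simp: link_def)
    then show ?case
      using step.IH by (auto intro: rtranclp.rtrancl_into_rtrancl)
  qed simp
  then show "(link G' W')\<^sup>*\<^sup>* u v"
    using uv fixed by simp
qed

lemma connected_in_neighbour:
  assumes "connected_in G W" "z \<in> W" "r \<in> W" "z \<noteq> r"
  shows "\<exists>s\<in>W. s \<noteq> z \<and> adj G z s"
proof -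
  have "(link G W)\<^sup>*\<^sup>* z r"
    using assms by (auto simp: connected_in_def)
  then have "z \<noteq> r \<longrightarrow> ?thesis"
  proof (induction rule: converse_rtranclp_induct)
    case (step a b)
    then show ?case by (cases "a = b") (auto simp: link_def)
  qed simp
  then show ?thesis using assms by simp
qed


section \<open>Perfect elimination orders of chordal graphs\<close>

definition simplicial_in :: "'a ugraph \<Rightarrow> 'a set \<Rightarrow> 'a \<Rightarrow> bool" where
  "simplicial_in G W z \<longleftrightarrow>
     z \<in> W \<and> (\<forall>a\<in>W. \<forall>b\<in>W. adj G z a \<and> adj G z b \<and> a \<noteq> b \<longrightarrow> adj G a b)"

lemma simplicial_in_mem: "simplicial_in G W z \<Longrightarrow> z \<in> W"
  by (simp add: simplicial_in_def)

text \<open>A shortest walk from \<open>s\<close> to \<open>s'\<close> through \<open>X\<close> has no chords. If \<open>s\<close> and \<open>s'\<close> were not adjacent,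
  \<open>v\<close> would close it to a chordless cycle of length at least four.\<close>

lemma chordal_neighbours_adj:
  assumes chordal: "chordal G"
    and verts: "insert v X \<subseteq> verts G" "v \<notin> X"
    and v: "adj G v s" "adj G v s'"
    and far: "\<And>x. x \<in> X \<Longrightarrow> x \<noteq> s \<Longrightarrow> x \<noteq> s' \<Longrightarrow> \<not> adj G v x"
    and walk: "(link G X)\<^sup>*\<^sup>* s s'" "s \<in> X"
    and neq: "s \<noteq> s'"
  shows "adj G s s'"
proof (rule ccontr)
  assume nadj: "\<not> adj G s s'"
  define Q where "Q p \<longleftrightarrow> p \<noteq> [] \<and> set p \<subseteq> X \<and> successively (adj G) p \<and> hd p = s \<and> last p = s'"
    for p
  have "\<exists>p. Q p"
    using link_rtranclp_imp_walk[OF walk] by (simp add: Q_def)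
  then obtain p where p: "Q p" and least: "\<And>q. Q q \<Longrightarrow> length p \<le> length q"
    using arg_min_nat_lemma[of Q _ length] by metis
  let ?n = "length p"
  have ne: "p \<noteq> []" and sub: "set p \<subseteq> X" and hd: "hd p = s" and last: "last p = s'"
    and succ: "successively (adj G) p"
    using p by (auto simp: Q_def)
  have nth0: "p ! 0 = s"
    using ne hd by (simp add: hd_conv_nth)
  have nthl: "p ! (?n - 1) = s'"
    using ne last by (simp add: last_conv_nth)
  have step: "adj G (p ! i) (p ! Suc i)" if "Suc i < ?n" for i
    using succ that by (simp add: successively_conv_nth)
  have "?n \<noteq> 1"
    using nth0 nthl neq by auto
  moreover have "?n \<noteq> 2"
    using nth0 nthl nadj step[of 0] by auto
  ultimately have len: "?n \<ge> 3"
    using ne by (cases ?n; cases "?n - 1") auto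
  have shortcut: False
    if ij: "Suc i < k" "k < ?n" and adj: "adj G (p ! i) (p ! k)" for i k
  proof -
    let ?q = "take (Suc i) p @ drop k p"
    have "successively (adj G) ?q"
    proof -
      have "successively (adj G) (take (Suc i) p)" "successively (adj G) (drop k p)"
        using succ by (metis append_take_drop_id successively_append_iff)+
      moreover have "last (take (Suc i) p) = p ! i"
        using ij by (simp add: take_Suc_conv_app_nth)
      moreover have "hd (drop k p) = p ! k"
        using ij by (simp add: hd_drop_conv_nth)
      ultimately show ?thesis
        using adj by (simp add: successively_append_iff)
    qed
    moreover have "set ?q \<subseteq> X"
      using sub set_take_subset[of "Suc i" p] set_drop_subset[of k p] by auto
    moreover have "hd ?q = s" "last ?q = s'"
      using ij hd last ne by auto
    ultimately have "Q ?q"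
      using ij by (auto simp: Q_def)
    then show False
      using least[of ?q] ij by auto
  qed
  have distinct: "distinct p"
    unfolding distinct_conv_nth
  proof (intro allI impI)
    have False if "i < j" "j < ?n" "p ! i = p ! j" for i j
    proof (cases "Suc j < ?n")
      case True
      then show False
        using shortcut[of i "Suc j"] step[of j] that by auto
    next
      case False
      then have "p ! i = s'" using that nthl by (metis Suc_lessI diff_Suc_1)
      moreover have "i \<noteq> 0" using \<open>p ! i = s'\<close> nth0 neq by metis
      moreover have "successively (adj G) (take (Suc i) p)"
        using succ by (metis append_take_drop_id successively_append_iff)
      moreover have "last (take (Suc i) p) = p ! i"
        using that by (simp add: take_Suc_conv_app_nth)
      ultimately have "Q (take (Suc i) p)"
        using ne sub hd set_take_subset[of "Suc i" p] by (auto simp: Q_def)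
      then show False
        using least[of "take (Suc i) p"] that by auto
    qed
    then show "p ! i \<noteq> p ! j" if "i < ?n" "j < ?n" "i \<noteq> j" for i j
      using that by (metis nat_neq_iff)
  qed
  let ?c = "v # p"
  have cyc_adj: "adj G (?c ! i) (?c ! (Suc i mod length ?c))" if i: "i < length ?c" for i
  proof -
    consider "i = 0" | "i = ?n" | j where "i = Suc j" "Suc j < ?n"
      using i by (cases i) (auto, linarith)
    then show ?thesis
    proof cases
      case 1
      then show ?thesis using v(1) nth0 ne by simp
    next
      case 2
      then show ?thesis using v(2) nthl len ne adj_commute[of G] by (simp add: nth_Cons')
    next
      case 3
      then show ?thesis using step[of j] by simp
    qed
  qed
  then have "is_cycle G ?c"
    using distinct verts sub len unfolding is_cycle_def by auto
  then have "has_chord G ?c"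
    using chordal len by (auto simp: chordal_def)
  then obtain a b where ab: "a \<in> set ?c" "b \<in> set ?c" "a \<noteq> b" "adj G a b" "{a, b} \<notin> cycle_edges ?c"
    by (auto simp: has_chord_def adj_def)
  have cyc: "{?c ! i, ?c ! (Suc i mod length ?c)} \<in> cycle_edges ?c" if "i < length ?c" for i
    using that by (auto simp: cycle_edges_def)
  have edges: "{v, s} \<in> cycle_edges ?c" "{s', v} \<in> cycle_edges ?c"
    "\<And>i. Suc i < ?n \<Longrightarrow> {p ! i, p ! Suc i} \<in> cycle_edges ?c"
  proof -
    show "{v, s} \<in> cycle_edges ?c"
      using cyc[of 0] nth0 ne by simp
    show "{s', v} \<in> cycle_edges ?c"
      using cyc[of ?n] nthl ne by (simp add: nth_Cons')
    show "{p ! i, p ! Suc i} \<in> cycle_edges ?c" if "Suc i < ?n" for i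
      using cyc[of "Suc i"] that by simp
  qed
  have no_v: False if "x \<in> set p" "adj G v x" "{v, x} \<notin> cycle_edges ?c" for x
  proof -
    have "x = s \<or> x = s'" using far[of x] sub that by blast
    then show False using edges(1,2) that(3) by (metis insert_commute)
  qed
  have no_p: False
    if "i < j" "j < ?n" "adj G (p ! i) (p ! j)" "{p ! i, p ! j} \<notin> cycle_edges ?c" for i j
    using that edges(3)[of i] shortcut[of i j] by (cases "j = Suc i") auto
  consider "a = v" "b \<in> set p" | "b = v" "a \<in> set p" | "a \<in> set p" "b \<in> set p"
    using ab by auto
  then show False
  proof cases
    case 1
    then show ?thesis using no_v ab by simp
  next
    case 2
    then show ?thesis using no_v[of a] ab adj_commute[of G] by (simp add: insert_commute)
  next
    case 3
    then obtain i j where "i < ?n" "a = p ! i" "j < ?n" "b = p ! j"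
      by (auto simp: in_set_conv_nth)
    then show ?thesis
      using no_p[of i j] no_p[of j i] ab adj_commute[of G]
      by (cases i j rule: linorder_cases) (auto simp: insert_commute)
  qed
qed

text \<open>Let \<open>K\<close> be a component of the part of \<open>W\<close> outside the closed neighbourhood of \<open>v\<close>, and \<open>S\<close> the
  set of vertices outside \<open>K\<close> that touch \<open>K\<close>. All of \<open>S\<close> is adjacent to \<open>v\<close>, so \<open>S\<close> is a clique by
  the previous lemma. Since the neighbours of a vertex of \<open>K\<close> lie in \<open>K \<union> S\<close>, it suffices to
  find a vertex of \<open>K\<close> that is simplicial in \<open>K \<union> S\<close>, which is smaller than \<open>W\<close> because it misses
  \<open>v\<close>. The induction hypothesis gives one as a non-neighbour of a suitable vertex.\<close>

lemma chordal_simplicial_non_neighbour: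
  assumes "chordal G" "finite W" "W \<subseteq> verts G" "v \<in> W" "u \<in> W" "u \<noteq> v" "\<not> adj G v u"
  shows "\<exists>z. simplicial_in G W z \<and> z \<noteq> v \<and> \<not> adj G v z"
  using assms(2-)
proof (induction "card W" arbitrary: W v u rule: less_induct)
  case less
  define far where "far = {x \<in> W. x \<noteq> v \<and> \<not> adj G v x}"
  define K where "K = {x. (link G far)\<^sup>*\<^sup>* u x}"
  define S where "S = {s \<in> W. adj G v s \<and> (\<exists>k\<in>K. adj G k s)}"
  have u: "u \<in> far" "u \<in> K"
    using less.prems by (auto simp: far_def K_def)
  have Kfar: "K \<subseteq> far"
  proof
    fix x assume "x \<in> K"
    then have "(link G far)\<^sup>*\<^sup>* u x" by (simp add: K_def)
    then show "x \<in> far" by (cases rule: rtranclp.cases) (use u in \<open>auto simp: link_def\<close>)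
  qed
  have closed: "x \<in> K \<union> S" if "k \<in> K" "x \<in> W" "adj G k x" for k x
  proof (cases "x \<in> far")
    case True
    then have "link G far k x" using that Kfar by (auto simp: link_def)
    then show ?thesis using that by (auto simp: K_def)
  next
    case False
    moreover have "x \<noteq> v"
      using that Kfar adj_commute[of G] by (auto simp: far_def)
    ultimately show ?thesis using that by (auto simp: far_def S_def)
  qed
  have vnot: "v \<notin> K \<union> S"
    using Kfar adj_commute[of G] by (auto simp: far_def S_def)
  have KW: "K \<union> S \<subseteq> W"
    using Kfar by (auto simp: far_def S_def)
  have K_link: "(link G K)\<^sup>*\<^sup>* u x" if "x \<in> K" for x
  proof -
    have "(link G far)\<^sup>*\<^sup>* u x" using that by (simp add: K_def)
    then show ?thesis
    proof (induction rule: rtranclp_induct)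
      case (step y z)
      then have "y \<in> K" "z \<in> K"
        by (auto simp: K_def intro: rtranclp.rtrancl_into_rtrancl)
      then have "link G K y z" using step by (auto simp: link_def)
      then show ?case using step by auto
    qed simp
  qed
  have clique: "adj G s s'" if s: "s \<in> S" "s' \<in> S" "s \<noteq> s'" for s s'
  proof -
    let ?X = "K \<union> {s, s'}"
    obtain k k' where k: "k \<in> K" "adj G k s" "k' \<in> K" "adj G k' s'"
      using s by (auto simp: S_def)
    have K_X: "(link G ?X)\<^sup>*\<^sup>* a b" if "(link G K)\<^sup>*\<^sup>* a b" for a b
      using that by (rule rtranclp_mono[THEN predicate2D, rotated]) (auto simp: link_def)
    have sym: "(link G ?X)\<^sup>*\<^sup>* b a" if "(link G ?X)\<^sup>*\<^sup>* a b" for a b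
    proof -
      have "symp (link G ?X)" by (auto simp: symp_def link_def adj_commute)
      then show ?thesis using that by (metis symp_rtranclp sympD)
    qed
    have "link G ?X s k" "link G ?X k' s'"
      using k adj_commute[of G] by (auto simp: link_def)
    moreover have "(link G ?X)\<^sup>*\<^sup>* k k'"
      using sym[OF K_X[OF K_link[OF k(1)]]] K_X[OF K_link[OF k(3)]] by (rule rtranclp_trans)
    ultimately have walk: "(link G ?X)\<^sup>*\<^sup>* s s'"
      by (meson converse_rtranclp_into_rtranclp rtranclp.rtrancl_into_rtrancl)
    show ?thesis
    proof (rule chordal_neighbours_adj[where v = v and X = ?X])
      show "insert v ?X \<subseteq> verts G"
        using KW s less.prems by auto
      show "\<not> adj G v x" if "x \<in> ?X" "x \<noteq> s" "x \<noteq> s'" for x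
        using that Kfar by (auto simp: far_def)
    qed (use assms(1) s vnot walk in \<open>auto simp: S_def\<close>)
  qed
  have smaller: "card (K \<union> S) < card W"
    using vnot KW less.prems by (intro psubset_card_mono) auto
  have IH: "\<exists>z. simplicial_in G (K \<union> S) z \<and> z \<noteq> y \<and> \<not> adj G y z"
    if "y \<in> K \<union> S" "x \<in> K \<union> S" "x \<noteq> y" "\<not> adj G y x" for x y
    using less.hyps[OF smaller] that KW less.prems finite_subset[OF KW] by blast
  (* The induction hypothesis is applied at a vertex of S if possible: the clique S then lies in
     its closed neighbourhood, so the simplicial vertex found is in K. Otherwise S is adjacent to
     everything, and a vertex of K works for the same reason, unless K and S form a clique. *)
  have "\<exists>z\<in>K. simplicial_in G (K \<union> S) z"
  proof (cases "\<exists>s\<in>S. \<exists>x\<in>K \<union> S. x \<noteq> s \<and> \<not> adj G s x")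
    case True
    then obtain s x where s: "s \<in> S" "x \<in> K \<union> S" "x \<noteq> s" "\<not> adj G s x" by blast
    then obtain z where z: "simplicial_in G (K \<union> S) z" "z \<noteq> s" "\<not> adj G s z"
      using IH[of s x] by blast
    have "z \<notin> S" using clique[OF s(1)] z(2,3) by metis
    then show ?thesis using z(1) simplicial_in_mem[OF z(1)] by blast
  next
    case S: False
    show ?thesis
    proof (cases "\<exists>k\<in>K. \<exists>x\<in>K \<union> S. x \<noteq> k \<and> \<not> adj G k x")
      case True
      then obtain k x where k: "k \<in> K" "x \<in> K \<union> S" "x \<noteq> k" "\<not> adj G k x" by blast
      then obtain z where z: "simplicial_in G (K \<union> S) z" "z \<noteq> k" "\<not> adj G k z"
        using IH[of k x] by blast
      have "z \<notin> S"
      proof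
        assume "z \<in> S"
        then have "adj G z k" using S k(1) z(2) by (metis UnI1)
        then show False using z(3) by (metis adj_commute)
      qed
      then show ?thesis using z(1) simplicial_in_mem[OF z(1)] by blast
    next
      case False
      have "adj G a b" if "a \<in> K \<union> S" "b \<in> K \<union> S" "a \<noteq> b" for a b
        using that S False by (metis UnE)
      then have "simplicial_in G (K \<union> S) u"
        using u(2) by (simp add: simplicial_in_def)
      then show ?thesis using u by blast
    qed
  qed
  then obtain z where "z \<in> K" "simplicial_in G (K \<union> S) z" by blast
  then have "simplicial_in G W z"
    using closed[OF \<open>z \<in> K\<close>] KW unfolding simplicial_in_def by (metis subsetD)
  then show ?case
    using \<open>z \<in> K\<close> Kfar by (auto simp: far_def)
qed

lemma chordal_simplicial_avoiding:
  assumes "chordal G" "finite W" "W \<subseteq> verts G" "r \<in> W" "W \<noteq> {r}"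
  shows "\<exists>z. simplicial_in G W z \<and> z \<noteq> r"
proof (cases "\<exists>v\<in>W. \<exists>u\<in>W. u \<noteq> v \<and> \<not> adj G v u")
  case True
  then obtain v u where vu: "v \<in> W" "u \<in> W" "u \<noteq> v" "\<not> adj G v u" by blast
  show ?thesis
  proof (cases "\<exists>u\<in>W. u \<noteq> r \<and> \<not> adj G r u")
    case True
    then show ?thesis
      using chordal_simplicial_non_neighbour assms by metis
  next
    case False
    then have "v \<noteq> r" "adj G v r" using vu by (metis adj_commute)+
    then show ?thesis
      using chordal_simplicial_non_neighbour[OF assms(1-3) vu] by metis
  qed
next
  case False
  then have "adj G a b" if "a \<in> W" "b \<in> W" "a \<noteq> b" for a b
    using that by metis
  moreover obtain z where "z \<in> W" "z \<noteq> r" using assms by blast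
  ultimately show ?thesis unfolding simplicial_in_def by metis
qed

text \<open>Vertices are removed in the order of increasing key. The last clause is perfect elimination:
  the later neighbours of a vertex form a clique.\<close>

definition rooted_perfect_key :: "'a ugraph \<Rightarrow> 'a set \<Rightarrow> 'a \<Rightarrow> ('a \<Rightarrow> nat) \<Rightarrow> bool" where
  "rooted_perfect_key G W r \<kappa> \<longleftrightarrow> inj_on \<kappa> W \<and>
     (\<forall>v\<in>W. v \<noteq> r \<longrightarrow> \<kappa> v < \<kappa> r \<and> (\<exists>u\<in>W. \<kappa> v < \<kappa> u \<and> adj G v u)) \<and>
     (\<forall>v\<in>W. \<forall>a\<in>W. \<forall>b\<in>W.
        \<kappa> v < \<kappa> a \<and> \<kappa> v < \<kappa> b \<and> adj G v a \<and> adj G v b \<and> a \<noteq> b \<longrightarrow> adj G a b)"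

text \<open>Remove a simplicial vertex \<open>z\<close> other than \<open>r\<close>. The rest stays connected because the neighbours
  of \<open>z\<close> are a clique, so that \<open>z\<close> can be folded onto any of them.\<close>

lemma chordal_rooted_perfect_key:
  assumes "chordal G" "finite W" "W \<subseteq> verts G" "connected_in G W" "r \<in> W"
  shows "\<exists>\<kappa>. rooted_perfect_key G W r \<kappa>"
  using assms(2-)
proof (induction "card W" arbitrary: W rule: less_induct)
  case less
  show ?case
  proof (cases "W = {r}")
    case True
    then show ?thesis by (intro exI[of _ "\<lambda>_. 0"]) (auto simp: rooted_perfect_key_def)
  next
    case False
    then obtain z where z: "simplicial_in G W z" "z \<noteq> r"
      using chordal_simplicial_avoiding assms(1) less.prems by metis
    then have zW: "z \<in> W" by (simp add: simplicial_in_mem)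
    let ?W = "W - {z}"
    obtain s where s: "s \<in> W" "s \<noteq> z" "adj G z s"
      using connected_in_neighbour[OF less.prems(3) zW less.prems(4) z(2)] by blast
    have "connected_in G ?W"
    proof (rule connected_in_retract[where f = "\<lambda>a. if a = z then s else a"])
      fix a b assume ab: "a \<in> W" "b \<in> W" "adj G a b"
      have nb: "x = s \<or> adj G s x" if "x \<in> W" "adj G z x" for x
        using z(1) s that unfolding simplicial_in_def by blast
      show "(if a = z then s else a) = (if b = z then s else b) \<or>
        adj G (if a = z then s else a) (if b = z then s else b)"
        using nb[of b] nb[of a] ab adj_commute[of G] by auto
    qed (use less.prems s in auto)
    then obtain \<kappa> where \<kappa>: "rooted_perfect_key G ?W r \<kappa>"
      using less.hyps[of ?W] less.prems z zW
      by (metis Diff_iff Diff_subset card_Diff1_less finite_Diff order_trans singletonD)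
    let ?\<kappa> = "\<lambda>v. if v = z then 0 else Suc (\<kappa> v)"
    have "rooted_perfect_key G W r ?\<kappa>"
      unfolding rooted_perfect_key_def
    proof (intro conjI ballI impI)
      show "inj_on ?\<kappa> W"
        using \<kappa> by (auto simp: rooted_perfect_key_def inj_on_def)
      fix v assume v: "v \<in> W"
      {
        assume "v \<noteq> r"
        show "?\<kappa> v < ?\<kappa> r"
          using \<kappa> z v \<open>v \<noteq> r\<close> by (auto simp: rooted_perfect_key_def)
        show "\<exists>u\<in>W. ?\<kappa> v < ?\<kappa> u \<and> adj G v u"
        proof (cases "v = z")
          case True
          then show ?thesis using s by auto
        next
          case False
          then obtain u where "u \<in> ?W" "\<kappa> v < \<kappa> u" "adj G v u"
            using \<kappa> v \<open>v \<noteq> r\<close> unfolding rooted_perfect_key_def by blast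
          then show ?thesis using False by auto
        qed
      }
      fix a b assume ab: "a \<in> W" "b \<in> W"
        "?\<kappa> v < ?\<kappa> a \<and> ?\<kappa> v < ?\<kappa> b \<and> adj G v a \<and> adj G v b \<and> a \<noteq> b"
      show "adj G a b"
      proof (cases "v = z")
        case True
        then show ?thesis using z(1) ab unfolding simplicial_in_def by blast
      next
        case False
        then have "a \<in> ?W" "b \<in> ?W" "v \<in> ?W" "\<kappa> v < \<kappa> a" "\<kappa> v < \<kappa> b"
          using ab v by (auto split: if_splits)
        then show ?thesis using \<kappa> ab unfolding rooted_perfect_key_def by blast
      qed
    qed
    then show ?thesis by blast
  qed
qed

section \<open>Distances in a board\<close>

lemma mem_nbhd_iff:
  "x \<in> nbhd G n B \<longleftrightarrow>
     x \<in> verts G \<and> (\<exists>b\<in>B. \<exists>p. walk_between G x p b \<and> length p \<le> Suc n)"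
proof -
  have le: "a \<le> enat n \<longleftrightarrow> a < enat (Suc n)" for a
    by (cases a) auto
  have len: "m - Suc 0 < Suc n \<longleftrightarrow> m \<le> Suc n" for m
    by arith
  show ?thesis
    by (auto simp: nbhd_def dist_to_set_def graph_dist_def le INF_less_iff len)
qed

lemma subset_nbhd: "x \<in> verts G \<Longrightarrow> x \<in> B \<Longrightarrow> x \<in> nbhd G n B"
  unfolding mem_nbhd_iff
  by (intro conjI bexI[of _ x] exI[of _ "[x]"]) (auto simp: walk_between_def)

lemma nbhd_step:
  assumes "y \<in> nbhd G n B" "x \<in> verts G" "adj G x y"
  shows "x \<in> nbhd G (Suc n) B"
proof -
  obtain b p where "b \<in> B" "walk_between G y p b" "length p \<le> Suc n"
    using assms(1) by (auto simp: mem_nbhd_iff)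
  then have "walk_between G x (x # p) b" "length (x # p) \<le> Suc (Suc n)"
    using assms by (auto simp: walk_between_def successively_Cons)
  then show ?thesis
    using \<open>b \<in> B\<close> assms(2) unfolding mem_nbhd_iff by blast
qed

lemma nbhd_mono: "m \<le> n \<Longrightarrow> nbhd G m B \<subseteq> nbhd G n B"
  by (auto simp: mem_nbhd_iff) (meson Suc_le_mono order_trans)


section \<open>Elimination keys and maximal configurations\<close>

text \<open>The set \<open>F\<close> stands for the colours below \<open>v\<close> that occur around a site coloured \<open>v\<close>; they are the
  only obstacle to replacing \<open>v\<close> by the colour \<open>w\<close>.\<close>

definition elimination_key :: "'h ugraph \<Rightarrow> ('h \<Rightarrow> nat) \<Rightarrow> bool" where
  "elimination_key H \<kappa> \<longleftrightarrow> inj_on \<kappa> (verts H) \<and>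
     (\<forall>v\<in>verts H. \<forall>F. (\<forall>f\<in>F. \<kappa> f < \<kappa> v \<and> adj H v f) \<longrightarrow>
        (\<exists>u\<in>verts H. \<kappa> v < \<kappa> u \<and> (\<forall>f\<in>F. adj H u f)) \<longrightarrow>
        (\<exists>w\<in>verts H. \<kappa> v < \<kappa> w \<and> (\<forall>f\<in>F. adj H w f) \<and>
           (\<forall>u\<in>verts H. \<kappa> v \<le> \<kappa> u \<and> adj H v u \<longrightarrow> adj H w u)))"

lemma elimination_keyE:
  assumes key: "elimination_key H \<kappa>" and v: "v \<in> verts H"
    and F: "\<forall>f\<in>F. \<kappa> f < \<kappa> v \<and> adj H v f"
    and u: "u \<in> verts H" "\<kappa> v < \<kappa> u" "\<forall>f\<in>F. adj H u f"
  obtains w where "w \<in> verts H" "\<kappa> v < \<kappa> w" "\<forall>f\<in>F. adj H w f"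
    "\<forall>u\<in>verts H. \<kappa> v \<le> \<kappa> u \<and> adj H v u \<longrightarrow> adj H w u"
proof -
  have "(\<forall>f\<in>F. \<kappa> f < \<kappa> v \<and> adj H v f) \<longrightarrow>
        (\<exists>u\<in>verts H. \<kappa> v < \<kappa> u \<and> (\<forall>f\<in>F. adj H u f)) \<longrightarrow>
        (\<exists>w\<in>verts H. \<kappa> v < \<kappa> w \<and> (\<forall>f\<in>F. adj H w f) \<and>
           (\<forall>u\<in>verts H. \<kappa> v \<le> \<kappa> u \<and> adj H v u \<longrightarrow> adj H w u))"
    using key v unfolding elimination_key_def by (elim conjE) (drule (1) bspec, erule spec)
  with F u that show thesis by blast
qed

lemma Hom_adj: "\<omega> \<in> Hom G H \<Longrightarrow> adj G x y \<Longrightarrow> adj H (\<omega> x) (\<omega> y)"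
  by (simp add: Hom_def)

lemma Hom_verts: "\<omega> \<in> Hom G H \<Longrightarrow> x \<in> verts G \<Longrightarrow> \<omega> x \<in> verts H"
  by (auto simp: Hom_def)

text \<open>Sites are raised independently of each other. If two adjacent sites of colour \<open>v\<close> are
  raised to \<open>w\<close> and \<open>w'\<close>, then \<open>v\<close> has a loop; so \<open>w\<close> is adjacent to \<open>v\<close>, and being a neighbour of \<open>v\<close>
  above \<open>v\<close> it is adjacent to \<open>w'\<close> as well.\<close>

lemma raise_colour_class:
  assumes key: "elimination_key H \<kappa>" and G: "wf_ugraph G"
    and \<omega>: "\<omega> \<in> Hom G H"
    and R: "R \<subseteq> verts G" "\<And>x. x \<in> R \<Longrightarrow> \<omega> x = v"
    and room: "\<And>x. x \<in> R \<Longrightarrow> \<exists>u\<in>verts H. \<kappa> v < \<kappa> u \<and>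
                 (\<forall>y. adj G x y \<and> \<kappa> (\<omega> y) < \<kappa> v \<longrightarrow> adj H u (\<omega> y))"
  shows "\<exists>\<omega>'\<in>Hom G H. (\<forall>x. x \<notin> R \<longrightarrow> \<omega>' x = \<omega> x) \<and> (\<forall>x\<in>R. \<kappa> v < \<kappa> (\<omega>' x))"
proof -
  have "\<exists>w\<in>verts H. \<kappa> v < \<kappa> w \<and> (\<forall>y. adj G x y \<and> \<kappa> (\<omega> y) < \<kappa> v \<longrightarrow> adj H w (\<omega> y)) \<and>
      (\<forall>u\<in>verts H. \<kappa> v \<le> \<kappa> u \<and> adj H v u \<longrightarrow> adj H w u)" if x: "x \<in> R" for x
  proof -
    let ?F = "{\<omega> y | y. adj G x y \<and> \<kappa> (\<omega> y) < \<kappa> v}"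
    have v: "v \<in> verts H"
      using Hom_verts[OF \<omega>, of x] R x by auto
    have F: "\<forall>f\<in>?F. \<kappa> f < \<kappa> v \<and> adj H v f"
      using Hom_adj[OF \<omega>, of x] R(2)[OF x] by auto
    obtain u where "u \<in> verts H" "\<kappa> v < \<kappa> u" "\<forall>f\<in>?F. adj H u f"
      using room[OF x] by blast
    then obtain w where "w \<in> verts H" "\<kappa> v < \<kappa> w" "\<forall>f\<in>?F. adj H w f"
      "\<forall>u\<in>verts H. \<kappa> v \<le> \<kappa> u \<and> adj H v u \<longrightarrow> adj H w u"
      by (rule elimination_keyE[OF key v F])
    then show ?thesis
      by (intro bexI[of _ w]) auto
  qed
  then have "\<forall>x\<in>R. \<exists>w. w \<in> verts H \<and> \<kappa> v < \<kappa> w \<and>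
      (\<forall>y. adj G x y \<and> \<kappa> (\<omega> y) < \<kappa> v \<longrightarrow> adj H w (\<omega> y)) \<and>
      (\<forall>u\<in>verts H. \<kappa> v \<le> \<kappa> u \<and> adj H v u \<longrightarrow> adj H w u)"
    by blast
  from bchoice[OF this] obtain w where "\<forall>x\<in>R. w x \<in> verts H \<and> \<kappa> v < \<kappa> (w x) \<and>
      (\<forall>y. adj G x y \<and> \<kappa> (\<omega> y) < \<kappa> v \<longrightarrow> adj H (w x) (\<omega> y)) \<and>
      (\<forall>u\<in>verts H. \<kappa> v \<le> \<kappa> u \<and> adj H v u \<longrightarrow> adj H (w x) u)"
    by blast
  then have w: "\<And>x. x \<in> R \<Longrightarrow> w x \<in> verts H" "\<And>x. x \<in> R \<Longrightarrow> \<kappa> v < \<kappa> (w x)"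
    "\<And>x y. x \<in> R \<Longrightarrow> adj G x y \<Longrightarrow> \<kappa> (\<omega> y) < \<kappa> v \<Longrightarrow> adj H (w x) (\<omega> y)"
    "\<And>x u. x \<in> R \<Longrightarrow> u \<in> verts H \<Longrightarrow> \<kappa> v \<le> \<kappa> u \<Longrightarrow> adj H v u \<Longrightarrow> adj H (w x) u"
    by blast+
  let ?\<omega> = "\<lambda>x. if x \<in> R then w x else \<omega> x"
  have mixed: "adj H (w x) (\<omega> y)" if "x \<in> R" "adj G x y" for x y
  proof (cases "\<kappa> (\<omega> y) < \<kappa> v")
    case False
    have "y \<in> verts G"
      using wf_ugraph_adj_verts(2)[OF G that(2)] .
    then show ?thesis
      using w(4)[of x "\<omega> y"] that False Hom_verts[OF \<omega>, of y] Hom_adj[OF \<omega> that(2)] R(2)[of x]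
      by simp
  qed (use w(3) that in auto)
  have both: "adj H (w x) (w y)" if "x \<in> R" "y \<in> R" "adj G x y" for x y
  proof -
    have "adj H v (w x)"
      using mixed[of x y] that R(2)[of y] by (simp add: adj_commute)
    then have "adj H (w y) (w x)"
      using w(4)[of y "w x"] w(1,2)[of x] that by simp
    then show ?thesis by (simp add: adj_commute)
  qed
  have "?\<omega> \<in> Hom G H"
    unfolding Hom_def
  proof (intro CollectI conjI allI impI)
    show "?\<omega> \<in> verts G \<rightarrow>\<^sub>E verts H"
      using \<omega> R(1) w(1) by (fastforce simp: Hom_def PiE_def extensional_def)
    show "adj H (?\<omega> x) (?\<omega> y)" if "adj G x y" for x y
      using that both[of x y] mixed[of x y] mixed[of y x] Hom_adj[OF \<omega> that]
      by (auto simp: adj_commute)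
  qed
  then show ?thesis
    using w(2) by (intro bexI[of _ ?\<omega>]) auto
qed

lemma cylinder_iff: "\<omega> \<in> cylinder G H A \<alpha> \<longleftrightarrow> \<omega> \<in> Hom G H \<and> restrict \<omega> A = \<alpha>"
  by (simp add: cylinder_def)

lemma cylinder_agree: "\<omega> \<in> cylinder G H A \<alpha> \<Longrightarrow> x \<in> A \<Longrightarrow> \<omega> x = \<alpha> x"
  by (auto simp: cylinder_def)

lemma cylinder_cong:
  assumes "\<omega> \<in> cylinder G H A \<alpha>" "\<omega>' \<in> Hom G H" "\<And>x. x \<in> A \<Longrightarrow> \<omega>' x = \<omega> x"
  shows "\<omega>' \<in> cylinder G H A \<alpha>"
  using assms by (auto simp: cylinder_def restrict_def)

text \<open>Where \<open>\<omega>\<close> has the colour of key \<open>i\<close> and \<open>\<omega>'\<close> differs, \<open>\<omega>'\<close> is larger and is compatible with all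
  smaller colours around the site, since there both configurations coincide. So \<open>\<omega>\<close> can be raised.
  None of these sites is in \<open>A\<close>, where the configurations agree.\<close>

lemma cylinder_raise:
  assumes key: "elimination_key H \<kappa>" and G: "wf_ugraph G"
    and \<omega>: "\<omega> \<in> cylinder G H A \<alpha>" and \<omega>': "\<omega>' \<in> cylinder G H A \<alpha>"
    and agree: "\<And>x. x \<in> verts G \<Longrightarrow> \<kappa> (\<omega> x) < i \<or> \<kappa> (\<omega>' x) < i \<Longrightarrow> \<omega> x = \<omega>' x"
  shows "\<exists>\<rho>\<in>cylinder G H A \<alpha>. \<forall>x\<in>verts G.
           if \<kappa> (\<omega> x) = i \<and> \<omega>' x \<noteq> \<omega> x then i < \<kappa> (\<rho> x) else \<rho> x = \<omega> x"
proof -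
  let ?R = "{x \<in> verts G. \<kappa> (\<omega> x) = i \<and> \<omega>' x \<noteq> \<omega> x}"
  have hom: "\<omega> \<in> Hom G H" "\<omega>' \<in> Hom G H"
    using \<omega> \<omega>' by (auto simp: cylinder_iff)
  have inj: "a = b" if "a \<in> verts H" "b \<in> verts H" "\<kappa> a = \<kappa> b" for a b
    using key that by (auto simp: elimination_key_def inj_on_def)
  show ?thesis
  proof (cases "?R = {}")
    case True
    then show ?thesis using \<omega> by (intro bexI[of _ \<omega>]) auto
  next
    case False
    then obtain x0 where x0: "x0 \<in> ?R" by blast
    define v where "v = \<omega> x0"
    have v: "\<kappa> v = i" "v \<in> verts H"
      using x0 Hom_verts[OF hom(1)] by (auto simp: v_def)
    have "\<exists>\<rho>\<in>Hom G H. (\<forall>x. x \<notin> ?R \<longrightarrow> \<rho> x = \<omega> x) \<and> (\<forall>x\<in>?R. \<kappa> v < \<kappa> (\<rho> x))"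
    proof (rule raise_colour_class[OF key G hom(1)])
      show "\<omega> x = v" if "x \<in> ?R" for x
        using that v Hom_verts[OF hom(1), of x] inj by auto
      show "\<exists>u\<in>verts H. \<kappa> v < \<kappa> u \<and>
          (\<forall>y. adj G x y \<and> \<kappa> (\<omega> y) < \<kappa> v \<longrightarrow> adj H u (\<omega> y))" if x: "x \<in> ?R" for x
      proof (intro bexI[of _ "\<omega>' x"] conjI allI impI)
        show "\<omega>' x \<in> verts H" using x Hom_verts[OF hom(2)] by auto
        have "\<kappa> (\<omega>' x) \<noteq> i"
          using x inj[of "\<omega> x" "\<omega>' x"] Hom_verts[OF hom(1), of x] Hom_verts[OF hom(2), of x] by auto
        moreover have "\<not> \<kappa> (\<omega>' x) < i"
          using x agree[of x] by auto
        ultimately show "\<kappa> v < \<kappa> (\<omega>' x)" using v by simp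
        fix y assume y: "adj G x y \<and> \<kappa> (\<omega> y) < \<kappa> v"
        then have "\<omega> y = \<omega>' y"
          using agree[of y] wf_ugraph_adj_verts(2)[OF G] v by auto
        then show "adj H (\<omega>' x) (\<omega> y)"
          using Hom_adj[OF hom(2)] y by auto
      qed
    qed auto
    then obtain \<rho> where \<rho>: "\<rho> \<in> Hom G H" "\<And>x. x \<notin> ?R \<Longrightarrow> \<rho> x = \<omega> x"
      "\<And>x. x \<in> ?R \<Longrightarrow> \<kappa> v < \<kappa> (\<rho> x)" by blast
    have "\<rho> x = \<omega> x" if "x \<in> A" for x
    proof (rule \<rho>(2))
      show "x \<notin> ?R" using that cylinder_agree[OF \<omega>] cylinder_agree[OF \<omega>'] by auto
    qed
    then have "\<rho> \<in> cylinder G H A \<alpha>"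
      using cylinder_cong[OF \<omega> \<rho>(1)] by blast
    then show ?thesis
      using \<rho>(2,3) v by (intro bexI[of _ \<rho>]) auto
  qed
qed

text \<open>At stage \<open>i\<close> the two configurations have been raised until they agree wherever one of them
  has a key below \<open>i\<close>. To pass to the next stage, first raise one of them, then the other one against
  the result.\<close>

lemma cylinder_directed:
  assumes key: "elimination_key H \<kappa>" and G: "wf_ugraph G" and H: "finite (verts H)"
    and \<omega>: "\<omega> \<in> cylinder G H A \<alpha>" and \<omega>': "\<omega>' \<in> cylinder G H A \<alpha>"
  shows "\<exists>\<rho>\<in>cylinder G H A \<alpha>. \<forall>x\<in>verts G. \<kappa> (\<omega> x) \<le> \<kappa> (\<rho> x) \<and> \<kappa> (\<omega>' x) \<le> \<kappa> (\<rho> x)"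
proof -
  have stage: "\<exists>\<sigma>\<in>cylinder G H A \<alpha>. \<exists>\<sigma>'\<in>cylinder G H A \<alpha>. \<forall>x\<in>verts G.
      \<kappa> (\<omega> x) \<le> \<kappa> (\<sigma> x) \<and> \<kappa> (\<omega>' x) \<le> \<kappa> (\<sigma>' x) \<and>
      (\<kappa> (\<sigma> x) < i \<or> \<kappa> (\<sigma>' x) < i \<longrightarrow> \<sigma> x = \<sigma>' x)" for i
  proof (induction i)
    case 0
    then show ?case using \<omega> \<omega>' by auto
  next
    case (Suc i)
    then obtain \<sigma> \<sigma>' where \<sigma>: "\<sigma> \<in> cylinder G H A \<alpha>" "\<sigma>' \<in> cylinder G H A \<alpha>"
      and le: "\<And>x. x \<in> verts G \<Longrightarrow> \<kappa> (\<omega> x) \<le> \<kappa> (\<sigma> x)" "\<And>x. x \<in> verts G \<Longrightarrow> \<kappa> (\<omega>' x) \<le> \<kappa> (\<sigma>' x)"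
      and eq: "\<And>x. x \<in> verts G \<Longrightarrow> \<kappa> (\<sigma> x) < i \<or> \<kappa> (\<sigma>' x) < i \<Longrightarrow> \<sigma> x = \<sigma>' x"
      by blast
    obtain \<tau> where \<tau>: "\<tau> \<in> cylinder G H A \<alpha>" "\<And>x. x \<in> verts G \<Longrightarrow>
        if \<kappa> (\<sigma> x) = i \<and> \<sigma>' x \<noteq> \<sigma> x then i < \<kappa> (\<tau> x) else \<tau> x = \<sigma> x"
      using cylinder_raise[OF key G \<sigma> eq] by blast
    have eq': "\<sigma>' x = \<tau> x" if "x \<in> verts G" "\<kappa> (\<sigma>' x) < i \<or> \<kappa> (\<tau> x) < i" for x
      using \<tau>(2)[OF that(1)] eq[OF that(1)] that(2) by (auto split: if_splits)
    obtain \<tau>' where \<tau>': "\<tau>' \<in> cylinder G H A \<alpha>" "\<And>x. x \<in> verts G \<Longrightarrow>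
        if \<kappa> (\<sigma>' x) = i \<and> \<tau> x \<noteq> \<sigma>' x then i < \<kappa> (\<tau>' x) else \<tau>' x = \<sigma>' x"
      using cylinder_raise[OF key G \<sigma>(2) \<tau>(1) eq'] by blast
    have "\<kappa> (\<omega> x) \<le> \<kappa> (\<tau> x) \<and> \<kappa> (\<omega>' x) \<le> \<kappa> (\<tau>' x) \<and>
        (\<kappa> (\<tau> x) < Suc i \<or> \<kappa> (\<tau>' x) < Suc i \<longrightarrow> \<tau> x = \<tau>' x)" if x: "x \<in> verts G" for x
    proof (intro conjI impI)
      show "\<kappa> (\<omega> x) \<le> \<kappa> (\<tau> x)"
        using \<tau>(2)[OF x] le(1)[OF x] by (cases "\<kappa> (\<sigma> x) = i \<and> \<sigma>' x \<noteq> \<sigma> x") simp_all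
      show "\<kappa> (\<omega>' x) \<le> \<kappa> (\<tau>' x)"
        using \<tau>'(2)[OF x] le(2)[OF x] by (cases "\<kappa> (\<sigma>' x) = i \<and> \<tau> x \<noteq> \<sigma>' x") simp_all
      assume low: "\<kappa> (\<tau> x) < Suc i \<or> \<kappa> (\<tau>' x) < Suc i"
      show "\<tau> x = \<tau>' x"
      proof (rule ccontr)
        assume "\<tau> x \<noteq> \<tau>' x"
        then have ne: "\<tau> x \<noteq> \<sigma>' x"
          using \<tau>'(2)[OF x] by metis
        then have ge: "i \<le> \<kappa> (\<sigma>' x)" "i \<le> \<kappa> (\<tau> x)"
          using eq'[OF x] by (metis not_less)+
        have "i < \<kappa> (\<tau> x)" "i < \<kappa> (\<tau>' x)"
          using \<tau>(2)[OF x] \<tau>'(2)[OF x] ge ne by (metis le_neq_implies_less)+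
        then show False using low by simp
      qed
    qed
    then show ?case using \<tau>(1) \<tau>'(1) by blast
  qed
  obtain N where N: "\<And>v. v \<in> verts H \<Longrightarrow> \<kappa> v < N"
    using finite_nat_set_iff_bounded[of "\<kappa> ` verts H"] H by auto
  obtain \<sigma> \<sigma>' where \<sigma>: "\<sigma> \<in> cylinder G H A \<alpha>" "\<sigma>' \<in> cylinder G H A \<alpha>"
    and *: "\<And>x. x \<in> verts G \<Longrightarrow> \<kappa> (\<omega> x) \<le> \<kappa> (\<sigma> x) \<and> \<kappa> (\<omega>' x) \<le> \<kappa> (\<sigma>' x) \<and>
      (\<kappa> (\<sigma> x) < N \<or> \<kappa> (\<sigma>' x) < N \<longrightarrow> \<sigma> x = \<sigma>' x)"
    using stage[of N] by blast
  have "\<kappa> (\<sigma> x) < N" if "x \<in> verts G" for x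
    using \<sigma>(1) that Hom_verts N unfolding cylinder_iff by metis
  then show ?thesis
    using * \<sigma>(1) by metis
qed

definition key_order :: "'h ugraph \<Rightarrow> ('h \<Rightarrow> nat) \<Rightarrow> 'h rel" where
  "key_order H \<kappa> = {(u, v). u \<in> verts H \<and> v \<in> verts H \<and> \<kappa> u < \<kappa> v}"

lemma strict_linear_key_order:
  assumes "inj_on \<kappa> (verts H)"
  shows "strict_linear_order_on (verts H) (key_order H \<kappa>)"
  using assms
  by (auto simp: strict_linear_order_on_def key_order_def trans_def irrefl_def total_on_def
      inj_on_def) (metis nat_neq_iff)

lemma config_le_key_order_iff:
  assumes "inj_on \<kappa> (verts H)" "\<omega> \<in> Hom G H" "\<omega>' \<in> Hom G H"
  shows "config_le G (key_order H \<kappa>) \<omega> \<omega>' \<longleftrightarrow> (\<forall>x\<in>verts G. \<kappa> (\<omega> x) \<le> \<kappa> (\<omega>' x))"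
  using Hom_verts[OF assms(2)] Hom_verts[OF assms(3)] assms(1)
  by (auto simp: config_le_def key_order_def inj_on_def le_less)

text \<open>The candidate takes at every site the largest value attained in the cylinder. To see that it
  respects an edge, choose a configuration attaining the value at either end; an upper
  bound of the two attains both values at once.\<close>

lemma max_config_exists:
  assumes key: "elimination_key H \<kappa>" and G: "wf_ugraph G" and H: "finite (verts H)"
    and \<alpha>: "\<alpha> \<in> language G H A" and A: "A \<subseteq> verts G"
  shows "\<exists>\<omega>m. max_config G H (key_order H \<kappa>) A \<alpha> \<omega>m"
proof -
  let ?C = "cylinder G H A \<alpha>"
  have inj: "inj_on \<kappa> (verts H)"
    using key by (simp add: elimination_key_def)
  obtain \<omega>0 where \<omega>0: "\<omega>0 \<in> ?C"
    using \<alpha> by (auto simp: language_def cylinder_def)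
  have "\<exists>\<omega>\<in>?C. \<forall>\<omega>'\<in>?C. \<kappa> (\<omega>' x) \<le> \<kappa> (\<omega> x)" if x: "x \<in> verts G" for x
  proof -
    have "(\<lambda>\<omega>. \<kappa> (\<omega> x)) ` ?C \<subseteq> \<kappa> ` verts H"
      using Hom_verts x by (fastforce simp: cylinder_iff)
    then have fin: "finite ((\<lambda>\<omega>. \<kappa> (\<omega> x)) ` ?C)"
      using H finite_subset by blast
    have "Max ((\<lambda>\<omega>. \<kappa> (\<omega> x)) ` ?C) \<in> (\<lambda>\<omega>. \<kappa> (\<omega> x)) ` ?C"
      using fin \<omega>0 by (intro Max_in) auto
    then obtain \<omega> where "\<omega> \<in> ?C" "\<kappa> (\<omega> x) = Max ((\<lambda>\<omega>. \<kappa> (\<omega> x)) ` ?C)"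
      by auto
    then show ?thesis
      using fin by (intro bexI[of _ \<omega>]) auto
  qed
  then obtain best where best: "\<And>x. x \<in> verts G \<Longrightarrow> best x \<in> ?C"
    "\<And>x \<omega>. x \<in> verts G \<Longrightarrow> \<omega> \<in> ?C \<Longrightarrow> \<kappa> (\<omega> x) \<le> \<kappa> (best x x)"
    by metis
  have top: "best x x = \<rho> x" if "x \<in> verts G" "\<rho> \<in> ?C" "\<kappa> (best x x) \<le> \<kappa> (\<rho> x)" for x \<rho>
  proof -
    have "\<kappa> (best x x) = \<kappa> (\<rho> x)"
      using best(2)[OF that(1,2)] that(3) by simp
    moreover have "best x x \<in> verts H" "\<rho> x \<in> verts H"
      using that best(1)[of x] Hom_verts by (auto simp: cylinder_iff)
    ultimately show ?thesis using inj by (auto dest: inj_onD)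
  qed
  define M where "M = (\<lambda>x\<in>verts G. best x x)"
  have "M \<in> Hom G H"
    unfolding Hom_def
  proof (intro CollectI conjI allI impI)
    show "M \<in> verts G \<rightarrow>\<^sub>E verts H"
    proof -
      have "best x x \<in> verts H" if "x \<in> verts G" for x
        using Hom_verts[of "best x" G H x] best(1)[OF that] that by (simp add: cylinder_iff)
      then show ?thesis by (simp add: M_def)
    qed
    fix x y assume adj: "adj G x y"
    then have xy: "x \<in> verts G" "y \<in> verts G"
      using wf_ugraph_adj_verts[OF G] by auto
    then obtain \<rho> where \<rho>: "\<rho> \<in> ?C" "\<kappa> (best x x) \<le> \<kappa> (\<rho> x)" "\<kappa> (best y y) \<le> \<kappa> (\<rho> y)"
      using cylinder_directed[OF key G H best(1)[OF xy(1)] best(1)[OF xy(2)]] by blast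
    then show "adj H (M x) (M y)"
      using top[OF xy(1) \<rho>(1,2)] top[OF xy(2) \<rho>(1,3)] xy adj Hom_adj[of \<rho> G H x y]
      by (simp add: M_def cylinder_iff)
  qed
  moreover have "M x = \<omega>0 x" if "x \<in> A" for x
    using that A cylinder_agree[OF best(1)] cylinder_agree[OF \<omega>0] by (auto simp: M_def)
  ultimately have M: "M \<in> ?C"
    using cylinder_cong[OF \<omega>0] by blast
  have "config_le G (key_order H \<kappa>) \<omega> M" if "\<omega> \<in> ?C" for \<omega>
  proof -
    have "\<kappa> (\<omega> x) \<le> \<kappa> (M x)" if "x \<in> verts G" for x
      using best(2)[OF that \<open>\<omega> \<in> ?C\<close>] that by (simp add: M_def)
    moreover have "\<omega> \<in> Hom G H" "M \<in> Hom G H"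
      using that M by (simp_all add: cylinder_iff)
    ultimately show ?thesis
      using config_le_key_order_iff[OF inj] by blast
  qed
  then show ?thesis
    using M unfolding max_config_def by blast
qed

lemma max_config_unique:
  assumes inj: "inj_on \<kappa> (verts H)"
    and "max_config G H (key_order H \<kappa>) A \<alpha> \<omega>" "max_config G H (key_order H \<kappa>) A \<alpha> \<omega>'"
  shows "\<omega> = \<omega>'"
proof -
  have hom: "\<omega> \<in> Hom G H" "\<omega>' \<in> Hom G H"
    using assms by (auto simp: max_config_def cylinder_iff)
  have "\<kappa> (\<omega> x) = \<kappa> (\<omega>' x)" if "x \<in> verts G" for x
    using assms that config_le_key_order_iff[OF inj] hom
    by (metis antisym max_config_def)
  then have "\<omega> x = \<omega>' x" if "x \<in> verts G" for x
    using inj Hom_verts[OF hom(1)] Hom_verts[OF hom(2)] that by (auto dest: inj_onD)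
  then show ?thesis
    using hom by (auto simp: Hom_def intro: PiE_ext)
qed

text \<open>If no neighbour of \<open>x\<close> with a colour below \<open>\<omega>1 x\<close> disagreed, then the value of \<open>\<omega>2\<close> at \<open>x\<close> would show
  that \<open>\<omega>1\<close> can be raised at \<open>x\<close>, against its maximality. In the step to a neighbour the two
  configurations may swap roles.\<close>

lemma max_config_disagreement:
  assumes key: "elimination_key H \<kappa>" and G: "wf_ugraph G" "loopless G" and H: "finite (verts H)"
    and max: "max_config G H (key_order H \<kappa>) A \<alpha>1 \<omega>1" "max_config G H (key_order H \<kappa>) A \<alpha>2 \<omega>2"
    and x: "x \<in> verts G" "\<kappa> (\<omega>1 x) < \<kappa> (\<omega>2 x)"
  shows "x \<in> nbhd G (card {u \<in> verts H. \<kappa> u < \<kappa> (\<omega>1 x)}) (disagreement A \<alpha>1 \<alpha>2)"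
  using max x
proof (induction "\<kappa> (\<omega>1 x)" arbitrary: \<omega>1 \<omega>2 \<alpha>1 \<alpha>2 x rule: less_induct)
  case less
  let ?D = "disagreement A \<alpha>1 \<alpha>2"
  have cyl: "\<omega>1 \<in> cylinder G H A \<alpha>1" "\<omega>2 \<in> cylinder G H A \<alpha>2"
    using less.prems by (auto simp: max_config_def)
  then have hom: "\<omega>1 \<in> Hom G H" "\<omega>2 \<in> Hom G H"
    by (auto simp: cylinder_iff)
  have inj: "inj_on \<kappa> (verts H)"
    using key by (simp add: elimination_key_def)
  show ?case
  proof (cases "x \<in> ?D")
    case True
    then show ?thesis using subset_nbhd less.prems by metis
  next
    case False
    then have xA: "x \<notin> A"
      using less.prems(4) cylinder_agree[OF cyl(1)] cylinder_agree[OF cyl(2)]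
      by (auto simp: disagreement_def)
    have "\<exists>y. adj G x y \<and> \<omega>1 y \<noteq> \<omega>2 y \<and> (\<kappa> (\<omega>1 y) < \<kappa> (\<omega>1 x))"
    proof (rule ccontr)
      assume none: "\<not> ?thesis"
      have "\<exists>\<rho>\<in>Hom G H. (\<forall>y. y \<notin> {x} \<longrightarrow> \<rho> y = \<omega>1 y) \<and> (\<forall>y\<in>{x}. \<kappa> (\<omega>1 x) < \<kappa> (\<rho> y))"
      proof (rule raise_colour_class[OF key G(1) hom(1)])
        show "\<exists>u\<in>verts H. \<kappa> (\<omega>1 x) < \<kappa> u \<and>
          (\<forall>y. adj G z y \<and> \<kappa> (\<omega>1 y) < \<kappa> (\<omega>1 x) \<longrightarrow> adj H u (\<omega>1 y))" if "z \<in> {x}" for z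
        proof (intro bexI[of _ "\<omega>2 x"] conjI allI impI)
          show "\<omega>2 x \<in> verts H" "\<kappa> (\<omega>1 x) < \<kappa> (\<omega>2 x)"
            using less.prems Hom_verts[OF hom(2)] by auto
          show "adj H (\<omega>2 x) (\<omega>1 y)" if "adj G z y \<and> \<kappa> (\<omega>1 y) < \<kappa> (\<omega>1 x)" for y
            using none that \<open>z \<in> {x}\<close> Hom_adj[OF hom(2), of x y] by auto
        qed
      qed (use less.prems in auto)
      then obtain \<rho> where \<rho>: "\<rho> \<in> Hom G H" "\<And>y. y \<noteq> x \<Longrightarrow> \<rho> y = \<omega>1 y" "\<kappa> (\<omega>1 x) < \<kappa> (\<rho> x)"
        by auto
      have "\<rho> \<in> cylinder G H A \<alpha>1"
        by (rule cylinder_cong[OF cyl(1) \<rho>(1)]) (use \<rho>(2) xA in metis)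
      then have "\<kappa> (\<rho> x) \<le> \<kappa> (\<omega>1 x)"
        using less.prems(1,3) config_le_key_order_iff[OF inj \<rho>(1) hom(1)]
        by (auto simp: max_config_def)
      then show False using \<rho>(3) by simp
    qed
    then obtain y where y: "adj G x y" "\<omega>1 y \<noteq> \<omega>2 y" "\<kappa> (\<omega>1 y) < \<kappa> (\<omega>1 x)" by blast
    then have yG: "y \<in> verts G"
      using wf_ugraph_adj_verts(2)[OF G(1)] by blast
    let ?below = "\<lambda>v. {u \<in> verts H. \<kappa> u < \<kappa> v}"
    have "\<kappa> (\<omega>1 y) \<noteq> \<kappa> (\<omega>2 y)"
      using y(2) inj Hom_verts[OF hom(1) yG] Hom_verts[OF hom(2) yG] by (auto dest: inj_onD)
    then consider "\<kappa> (\<omega>1 y) < \<kappa> (\<omega>2 y)" | "\<kappa> (\<omega>2 y) < \<kappa> (\<omega>1 y)" by linarith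
    then have "\<exists>v. \<kappa> v < \<kappa> (\<omega>1 x) \<and> v \<in> verts H \<and> y \<in> nbhd G (card (?below v)) ?D"
    proof cases
      case 1
      then show ?thesis
        using less.hyps[OF y(3) less.prems(1,2) yG] y(3) Hom_verts[OF hom(1) yG] by blast
    next
      case 2
      have "disagreement A \<alpha>2 \<alpha>1 = ?D" by (auto simp: disagreement_def)
      then show ?thesis
        using less.hyps[OF _ less.prems(2,1) yG 2] 2 y(3) Hom_verts[OF hom(2) yG]
        by (intro exI[of _ "\<omega>2 y"]) auto
    qed
    then obtain v where v: "\<kappa> v < \<kappa> (\<omega>1 x)" "v \<in> verts H" "y \<in> nbhd G (card (?below v)) ?D"
      by blast
    have "card (?below v) < card (?below (\<omega>1 x))"
      using v H by (intro psubset_card_mono) auto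
    then show ?thesis
      using subsetD[OF nbhd_mono[OF Suc_leI] nbhd_step[OF v(3) less.prems(3) y(1)]] by simp
  qed
qed

lemma UMC_if_elimination_key:
  assumes key: "elimination_key H \<kappa>" and G: "wf_ugraph G" "loopless G" and H: "finite (verts H)"
  shows "UMC G H (card (verts H) - 2)"
proof -
  let ?r = "key_order H \<kappa>"
  have inj: "inj_on \<kappa> (verts H)"
    using key by (simp add: elimination_key_def)
  have near: "x \<in> nbhd G (card (verts H) - 2) (disagreement A \<alpha>1 \<alpha>2)"
    if max: "max_config G H ?r A \<alpha>1 \<omega>1" "max_config G H ?r A \<alpha>2 \<omega>2"
      and x: "x \<in> verts G" "\<kappa> (\<omega>1 x) < \<kappa> (\<omega>2 x)" for A \<alpha>1 \<alpha>2 \<omega>1 \<omega>2 x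
  proof -
    have "\<omega>1 x \<in> verts H" "\<omega>2 x \<in> verts H"
      using max x Hom_verts by (auto simp: max_config_def cylinder_iff)
    then have "{u \<in> verts H. \<kappa> u < \<kappa> (\<omega>1 x)} \<subseteq> verts H - {\<omega>1 x, \<omega>2 x}"
      "card (verts H - {\<omega>1 x, \<omega>2 x}) = card (verts H) - 2"
      using x(2) H by (auto simp: card_Diff_subset card_insert_if)
    then have "card {u \<in> verts H. \<kappa> u < \<kappa> (\<omega>1 x)} \<le> card (verts H) - 2"
      using H by (metis card_mono finite_Diff)
    then show ?thesis
      using max_config_disagreement[OF key G H max x] subsetD[OF nbhd_mono] by metis
  qed
  have "disagreement (verts G) \<omega>1 \<omega>2 \<subseteq> nbhd G (card (verts H) - 2) (disagreement A \<alpha>1 \<alpha>2)"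
    if max: "max_config G H ?r A \<alpha>1 \<omega>1" "max_config G H ?r A \<alpha>2 \<omega>2" for A \<alpha>1 \<alpha>2 \<omega>1 \<omega>2
  proof
    fix x assume "x \<in> disagreement (verts G) \<omega>1 \<omega>2"
    then have x: "x \<in> verts G" "\<omega>1 x \<noteq> \<omega>2 x" by (auto simp: disagreement_def)
    then have "\<omega>1 x \<in> verts H" "\<omega>2 x \<in> verts H"
      using max Hom_verts by (auto simp: max_config_def cylinder_iff)
    then have "\<kappa> (\<omega>1 x) \<noteq> \<kappa> (\<omega>2 x)"
      using x inj by (auto dest: inj_onD)
    moreover have "disagreement A \<alpha>2 \<alpha>1 = disagreement A \<alpha>1 \<alpha>2" by (auto simp: disagreement_def)
    ultimately show "x \<in> nbhd G (card (verts H) - 2) (disagreement A \<alpha>1 \<alpha>2)"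
      using near[OF max x(1)] near[OF max(2,1) x(1)] by (metis nat_neq_iff)
  qed
  moreover have "\<exists>!\<omega>m. max_config G H ?r A \<alpha> \<omega>m" if "\<alpha> \<in> language G H A" "A \<subseteq> verts G" for A \<alpha>
    using max_config_exists[OF key G(1) H that] max_config_unique[OF inj] by blast
  ultimately show ?thesis
    unfolding UMC_def using strict_linear_key_order[OF inj] by (intro exI[of _ ?r]) blast
qed

section \<open>The elimination key of a chordal/tree decomposition\<close>

lemma lexicographic_key:
  fixes cls loc :: "'a \<Rightarrow> nat"
  assumes "finite V"
    and sep: "\<And>u v. u \<in> V \<Longrightarrow> v \<in> V \<Longrightarrow> cls u = cls v \<Longrightarrow> loc u = loc v \<Longrightarrow> u = v"
  shows "\<exists>\<kappa> :: 'a \<Rightarrow> nat. inj_on \<kappa> V \<and>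
    (\<forall>u\<in>V. \<forall>v\<in>V. \<kappa> u < \<kappa> v \<longleftrightarrow> cls u < cls v \<or> cls u = cls v \<and> loc u < loc v)"
proof -
  obtain N where N: "\<And>v. v \<in> V \<Longrightarrow> loc v < N"
    using finite_nat_set_iff_bounded[of "loc ` V"] assms(1) by auto
  define \<kappa> where "\<kappa> v = cls v * N + loc v" for v
  have mono: "\<kappa> u < \<kappa> v" if "u \<in> V" "cls u < cls v \<or> cls u = cls v \<and> loc u < loc v" for u v
  proof (cases "cls u < cls v")
    case True
    have "\<kappa> u < Suc (cls u) * N"
      using N[OF that(1)] by (simp add: \<kappa>_def)
    also have "\<dots> \<le> cls v * N"
      using True by (intro mult_right_mono) auto
    finally show ?thesis by (simp add: \<kappa>_def)
  qed (use that in \<open>auto simp: \<kappa>_def\<close>)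
  have iff: "\<kappa> u < \<kappa> v \<longleftrightarrow> cls u < cls v \<or> cls u = cls v \<and> loc u < loc v"
    if "u \<in> V" "v \<in> V" for u v
    using mono[of u v] mono[of v u] sep[of u v] that by (metis less_asym linorder_neqE_nat less_irrefl)
  moreover have "inj_on \<kappa> V"
    using iff sep by (intro inj_onI) (metis less_irrefl linorder_neqE_nat)
  ultimately show ?thesis by blast
qed

lemma adj_induced: "adj (induced G A) u v \<longleftrightarrow> adj G u v \<and> u \<in> A \<and> v \<in> A"
  by (auto simp: adj_def induced_def)

lemma adj_delete_loops: "adj (delete_loops G) u v \<longleftrightarrow> adj G u v \<and> u \<noteq> v"
  by (auto simp: adj_def delete_loops_def doubleton_eq_iff)

lemma triangle_is_cycle:
  assumes "adj G a b" "adj G b c" "adj G c a" "distinct [a, b, c]" "{a, b, c} \<subseteq> verts G"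
  shows "is_cycle G [a, b, c]"
proof -
  have "adj G ([a, b, c] ! i) ([a, b, c] ! (Suc i mod length [a, b, c]))"
    if "i < length [a, b, c]" for i
  proof -
    have "i = 0 \<or> i = 1 \<or> i = 2" using that by (auto simp: less_Suc_eq numeral_2_eq_2)
    then show ?thesis using assms(1-3) by (elim disjE) simp_all
  qed
  then show ?thesis using assms(4,5) unfolding is_cycle_def by simp
qed

lemma loop_is_cycle: "adj G a a \<Longrightarrow> a \<in> verts G \<Longrightarrow> is_cycle G [a]"
  by (auto simp: is_cycle_def)

text \<open>A decomposition with its attachment vertices named: \<open>root j\<close> and \<open>anchor j\<close> are \<open>r\<^sub>j\<close> and \<open>c\<^sup>j\<close>, and
  \<open>hub k\<close> is \<open>c\<^sup>k\<close>.\<close>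

locale chordal_tree_decomposition =
  fixes H :: "'h ugraph" and C :: "'h set"
    and m :: nat and Ts :: "nat \<Rightarrow> 'h set" and root anchor :: "nat \<Rightarrow> 'h"
    and n :: nat and Js :: "nat \<Rightarrow> 'h set" and hub :: "nat \<Rightarrow> 'h"
  assumes wf: "wf_ugraph H" and fin: "finite (verts H)" and conn: "connected_ugraph H"
    and verts: "verts H = C \<union> (\<Union>j\<in>{1..m}. Ts j) \<union> (\<Union>k\<in>{1..n}. Js k)"
    and C_ne: "C \<noteq> {}" and C_chordal: "loop_chordal (induced H C)"
    and C_T: "C \<inter> (\<Union>j\<in>{1..m}. Ts j) = {}" and C_J: "C \<inter> (\<Union>k\<in>{1..n}. Js k) = {}"
    and T_J: "(\<Union>j\<in>{1..m}. Ts j) \<inter> (\<Union>k\<in>{1..n}. Js k) = {}"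
    and Ts_disj: "disjoint_family_on Ts {1..m}" and Js_disj: "disjoint_family_on Js {1..n}"
    and tree: "j \<in> {1..m} \<Longrightarrow> is_tree (induced H (Ts j))"
    and root: "j \<in> {1..m} \<Longrightarrow> root j \<in> Ts j \<and> anchor j \<in> C \<and> adj H (root j) (anchor j)"
    and root_unique: "j \<in> {1..m} \<Longrightarrow> t \<in> Ts j \<Longrightarrow> c \<in> C \<Longrightarrow> adj H t c \<Longrightarrow> t = root j \<and> c = anchor j"
    and hub: "k \<in> {1..n} \<Longrightarrow> hub k \<in> C"
    and hub_iff: "k \<in> {1..n} \<Longrightarrow> u \<in> Js k \<Longrightarrow> c \<in> C \<Longrightarrow> adj H u c \<longleftrightarrow> c = hub k"
    and no_T_J: "edges_between H (\<Union>j\<in>{1..m}. Ts j) (\<Union>k\<in>{1..n}. Js k) = {}"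
    and no_T_T: "i \<in> {1..m} \<Longrightarrow> j \<in> {1..m} \<Longrightarrow> i \<noteq> j \<Longrightarrow> edges_between H (Ts i) (Ts j) = {}"
    and no_J_J: "k \<in> {1..n} \<Longrightarrow> l \<in> {1..n} \<Longrightarrow> k \<noteq> l \<Longrightarrow> edges_between H (Js k) (Js l) = {}"
begin

definition T :: "'h set" where "T = (\<Union>j\<in>{1..m}. Ts j)"

definition J :: "'h set" where "J = (\<Union>k\<in>{1..n}. Js k)"

lemma no_edge: "edges_between H X Y = {} \<Longrightarrow> a \<in> X \<Longrightarrow> b \<in> Y \<Longrightarrow> \<not> adj H a b"
  unfolding edges_between_def adj_def by blast

lemma partition: "verts H = C \<union> T \<union> J" "C \<inter> T = {}" "C \<inter> J = {}" "T \<inter> J = {}"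
  using verts C_T C_J T_J by (simp_all add: T_def J_def)

lemma vertex_cases:
  assumes "v \<in> verts H"
  obtains (C) "v \<in> C" | (T) j where "j \<in> {1..m}" "v \<in> Ts j" | (J) k where "k \<in> {1..n}" "v \<in> Js k"
  using assms partition(1) unfolding T_def J_def by blast

lemma tree_neighbour:
  assumes "j \<in> {1..m}" "t \<in> Ts j" "adj H t v"
  shows "v \<in> Ts j \<or> t = root j \<and> v = anchor j"
proof -
  have "v \<in> verts H" using wf_ugraph_adj_verts(2)[OF wf assms(3)] .
  then show ?thesis
  proof (cases rule: vertex_cases)
    case C
    then show ?thesis using root_unique assms by blast
  next
    case (T i)
    then show ?thesis using no_edge[OF no_T_T] assms by metis
  next
    case (J k)
    then show ?thesis using no_edge[OF no_T_J, of t v] assms by blast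
  qed
qed

lemma hub_part_neighbour:
  assumes "k \<in> {1..n}" "u \<in> Js k" "adj H u v"
  shows "v \<in> Js k \<or> v = hub k"
proof -
  have "v \<in> verts H" using wf_ugraph_adj_verts(2)[OF wf assms(3)] .
  then show ?thesis
  proof (cases rule: vertex_cases)
    case C
    then show ?thesis using hub_iff assms by blast
  next
    case (T j)
    moreover have "adj H v u" using assms(3) by (simp add: adj_commute)
    ultimately show ?thesis using no_edge[OF no_T_J, of v u] assms by blast
  next
    case (J l)
    then show ?thesis using no_edge[OF no_J_J] assms by metis
  qed
qed

lemma C_loop: "c \<in> C \<Longrightarrow> adj H c c"
  using C_chordal partition(1) by (auto simp: loop_chordal_def induced_def adj_def)

definition tree_index :: "'h \<Rightarrow> nat" where
  "tree_index v = (THE j. j \<in> {1..m} \<and> v \<in> Ts j)"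

definition hub_index :: "'h \<Rightarrow> nat" where
  "hub_index v = (THE k. k \<in> {1..n} \<and> v \<in> Js k)"

lemma tree_index: "j \<in> {1..m} \<Longrightarrow> v \<in> Ts j \<Longrightarrow> tree_index v = j"
  unfolding tree_index_def using disjoint_family_onD[OF Ts_disj]
  by (intro the_equality) (blast, metis disjoint_iff)

lemma hub_index: "k \<in> {1..n} \<Longrightarrow> v \<in> Js k \<Longrightarrow> hub_index v = k"
  unfolding hub_index_def using disjoint_family_onD[OF Js_disj]
  by (intro the_equality) (blast, metis disjoint_iff)

abbreviation CG :: "'h ugraph" where "CG \<equiv> delete_loops (induced H C)"

lemma adj_CG: "adj CG u v \<longleftrightarrow> adj H u v \<and> u \<in> C \<and> v \<in> C \<and> u \<noteq> v"
  by (auto simp: adj_delete_loops adj_induced)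

lemma verts_CG: "verts CG = C"
  using partition(1) by (auto simp: delete_loops_def induced_def)

text \<open>Contracting each tree to its anchor and each hub part to its hub retracts \<open>H\<close> onto \<open>C\<close>.\<close>

lemma connected_C: "connected_in CG C"
proof -
  define f where "f v = (if v \<in> C then v else if v \<in> T then anchor (tree_index v) else hub (hub_index v))"
    for v
  have f_C: "f v = v" if "v \<in> C" for v
    using that by (simp add: f_def)
  have f_T: "f v = anchor j" if "j \<in> {1..m}" "v \<in> Ts j" for j v
  proof -
    have "v \<in> T" using that by (auto simp: T_def)
    moreover from this have "v \<notin> C" using partition(2) by auto
    ultimately show ?thesis using tree_index[OF that] by (simp add: f_def)
  qed
  have f_J: "f v = hub k" if "k \<in> {1..n}" "v \<in> Js k" for k v
  proof -
    have "v \<in> J" using that by (auto simp: J_def)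
    then have "v \<notin> C" "v \<notin> T" using partition(3,4) by auto
    then show ?thesis using hub_index[OF that] by (simp add: f_def)
  qed
  have outside: "f a = f b" if "a \<in> verts H" "a \<notin> C" "adj H a b" for a b
    using that(1)
  proof (cases rule: vertex_cases)
    case C
    then show ?thesis using that by simp
  next
    case (T j)
    then show ?thesis
      using tree_neighbour[OF T that(3)] root[OF T(1)] f_T[OF T(1)] f_C by auto
  next
    case (J k)
    then show ?thesis
      using hub_part_neighbour[OF J that(3)] hub[OF J(1)] f_J[OF J(1)] f_C by auto
  qed
  show ?thesis
  proof (rule connected_in_retract[where f = f])
    show "connected_in H (verts H)"
      using connected_ugraph_imp_connected_in[OF conn] .
    show "f a \<in> C" if "a \<in> verts H" for a
      using that
    proof (cases rule: vertex_cases)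
      case C then show ?thesis by (simp add: f_C)
    next
      case (T j) then show ?thesis using f_T[OF T] root by simp
    next
      case (J k) then show ?thesis using f_J[OF J] hub by simp
    qed
    show "f a = f b \<or> adj CG (f a) (f b)" if "a \<in> verts H" "b \<in> verts H" "adj H a b" for a b
    proof (cases "a \<in> C \<and> b \<in> C")
      case True
      then show ?thesis using that by (auto simp: f_C adj_CG)
    next
      case False
      then show ?thesis
        using outside[of a b] outside[of b a] that by (metis adj_commute)
    qed
  qed (use partition(1) f_C in auto)
qed

lemma core_key: "\<exists>r \<kappa>. r \<in> C \<and> rooted_perfect_key CG C r \<kappa>"
proof -
  obtain r where "r \<in> C" using C_ne by blast
  moreover have "chordal CG"
    using C_chordal by (simp add: loop_chordal_def)
  moreover have "finite C"
    using fin partition(1) by (metis finite_Un)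
  ultimately show ?thesis
    using chordal_rooted_perfect_key[OF _ _ _ connected_C] verts_CG by blast
qed

lemma verts_tree: "j \<in> {1..m} \<Longrightarrow> verts (induced H (Ts j)) = Ts j"
  using partition(1) by (auto simp: induced_def T_def)

lemma tree_key:
  assumes "j \<in> {1..m}"
  shows "\<exists>\<kappa>. rooted_perfect_key (induced H (Ts j)) (Ts j) (root j) \<kappa>"
proof (rule chordal_rooted_perfect_key)
  show "chordal (induced H (Ts j))"
    using tree[OF assms] by (auto simp: is_tree_def chordal_def)
  show "connected_in (induced H (Ts j)) (Ts j)"
    using tree[OF assms] connected_ugraph_imp_connected_in[of "induced H (Ts j)"] verts_tree[OF assms]
    by (simp add: is_tree_def)
  have "Ts j \<subseteq> verts H"
    using assms partition(1) by (auto simp: T_def)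
  then show "finite (Ts j)"
    using fin finite_subset by blast
qed (use assms root verts_tree in auto)

lemma tree_no_loop:
  assumes "j \<in> {1..m}" "t \<in> Ts j"
  shows "\<not> adj H t t"
  using loop_is_cycle[of "induced H (Ts j)" t] tree[OF assms(1)] assms(2)
  unfolding is_tree_def adj_induced verts_tree[OF assms(1)] by blast

lemma tree_no_triangle:
  assumes "j \<in> {1..m}" "{a, b, c} \<subseteq> Ts j" "distinct [a, b, c]" "adj H a b" "adj H b c"
  shows "\<not> adj H c a"
  using triangle_is_cycle[of "induced H (Ts j)" a b c] tree[OF assms(1)] assms(2-)
  unfolding is_tree_def adj_induced verts_tree[OF assms(1)] by blast

text \<open>The key is lexicographic: first the part, with \<open>J\<close> below all trees and \<open>C\<close> on top, then the order
  inside the part. Within \<open>J\<close> any order works because every colour there can be raised to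
  its hub, which is adjacent to everything that any member of the same part is adjacent to.
  Smaller neighbours of a tree vertex are its children. A child leaves no choice but the colour
  itself, as it has only this one later neighbour; without children around, the grandparent
  can be used, as the parent is the only later neighbour. For a vertex of \<open>C\<close>, a
  smaller neighbour outside \<open>C\<close> again leaves no choice, and one inside \<open>C\<close> has a clique of later
  neighbours, so that every larger colour compatible with it is adjacent to the vertex.\<close>

lemma elimination_key_exists: "\<exists>\<kappa>. elimination_key H \<kappa>"
proof -
  obtain c0 \<kappa>C where c0: "c0 \<in> C" and \<kappa>C: "rooted_perfect_key CG C c0 \<kappa>C"
    using core_key by blast
  obtain \<kappa>T where \<kappa>T:
    "\<And>j. j \<in> {1..m} \<Longrightarrow> rooted_perfect_key (induced H (Ts j)) (Ts j) (root j) (\<kappa>T j)"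
    using tree_key by metis
  obtain \<kappa>J :: "'h \<Rightarrow> nat" where \<kappa>J: "inj_on \<kappa>J J"
    using finite_imp_inj_to_nat_seg fin partition(1) by (metis finite_Un)
  define cls where "cls v = (if v \<in> J then 0 else if v \<in> C then Suc m else tree_index v)" for v
  define loc where
    "loc v = (if v \<in> J then \<kappa>J v else if v \<in> C then \<kappa>C v else \<kappa>T (tree_index v) v)" for v
  have J_mem: "v \<in> J" if "k \<in> {1..n}" "v \<in> Js k" for k v
    using that by (auto simp: J_def)
  have in_V: "v \<in> verts H" if "v \<in> C \<or> v \<in> J \<or> j \<in> {1..m} \<and> v \<in> Ts j" for v j
    using that partition(1) by (auto simp: T_def)
  have cl_C: "cls v = Suc m" "loc v = \<kappa>C v" if "v \<in> C" for v
    using that partition(3) by (auto simp: cls_def loc_def)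
  have cl_J: "cls v = 0" "loc v = \<kappa>J v" if "v \<in> J" for v
    using that by (auto simp: cls_def loc_def)
  have cl_T: "cls v = j" "loc v = \<kappa>T j v" if "j \<in> {1..m}" "v \<in> Ts j" for v j
  proof -
    have "v \<in> T" using that by (auto simp: T_def)
    then have "v \<notin> C" "v \<notin> J" using partition(2,4) by auto
    then show "cls v = j" "loc v = \<kappa>T j v"
      using tree_index[OF that] by (simp_all add: cls_def loc_def)
  qed
  have cls_C: "v \<in> C" if "v \<in> verts H" "Suc m \<le> cls v" for v
    using that(1)
  proof (cases rule: vertex_cases)
    case (T j) then show ?thesis using cl_T[OF T] that(2) by simp
  next
    case (J k) then show ?thesis using cl_J[OF J_mem[OF J]] that(2) by simp
  qed
  have cls_T: "v \<in> Ts j" if "v \<in> verts H" "cls v = j" "j \<in> {1..m}" for v j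
    using that(1)
  proof (cases rule: vertex_cases)
    case C then show ?thesis using cl_C[OF C] that by simp
  next
    case (T i) then show ?thesis using cl_T[OF T] that by simp
  next
    case (J k) then show ?thesis using cl_J[OF J_mem[OF J]] that by simp
  qed
  have cls_J: "v \<in> J" if "v \<in> verts H" "cls v = 0" for v
    using that(1)
  proof (cases rule: vertex_cases)
    case C then show ?thesis using cl_C[OF C] that by simp
  next
    case (T i) then show ?thesis using cl_T[OF T] that by simp
  next
    case (J k) then show ?thesis using J_mem by blast
  qed
  have sep: "u = v" if "u \<in> verts H" "v \<in> verts H" "cls u = cls v" "loc u = loc v" for u v
    using that(1)
  proof (cases rule: vertex_cases)
    case C
    then have "v \<in> C" using cls_C[of v] cl_C[OF C] that by simp
    then show ?thesis
      using C that(4) cl_C \<kappa>C by (auto simp: rooted_perfect_key_def dest: inj_onD)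
  next
    case (T j)
    then have "v \<in> Ts j" using cls_T[of v j] cl_T[OF T] that by simp
    then show ?thesis
      using T that(4) cl_T[OF T(1)] \<kappa>T[OF T(1)] by (auto simp: rooted_perfect_key_def dest: inj_onD)
  next
    case (J k)
    then have "u \<in> J" using J_mem by blast
    moreover have "v \<in> J" using cls_J[of v] cl_J[OF \<open>u \<in> J\<close>] that by simp
    ultimately show ?thesis
      using that(4) cl_J \<kappa>J by (auto dest: inj_onD)
  qed
  have "\<exists>\<kappa> :: 'h \<Rightarrow> nat. inj_on \<kappa> (verts H) \<and> (\<forall>u\<in>verts H. \<forall>v\<in>verts H.
      \<kappa> u < \<kappa> v \<longleftrightarrow> cls u < cls v \<or> cls u = cls v \<and> loc u < loc v)"
    using fin sep by (rule lexicographic_key)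
  then obtain \<kappa> :: "'h \<Rightarrow> nat" where inj: "inj_on \<kappa> (verts H)" and lex_all: "\<forall>u\<in>verts H. \<forall>v\<in>verts H.
      \<kappa> u < \<kappa> v \<longleftrightarrow> cls u < cls v \<or> cls u = cls v \<and> loc u < loc v"
    by blast
  note lex = lex_all[rule_format]
  have below_C: "\<kappa> u < \<kappa> c" if "u \<in> verts H" "u \<notin> C" "c \<in> C" for u c
  proof -
    have "cls u < cls c"
      using cls_C[of u] cl_C(1)[OF that(3)] that(1,2) by (metis not_less)
    then show ?thesis using lex[of u c] that(1,3) in_V[of c] by simp
  qed
  have less_C: "\<kappa> u < \<kappa> c \<longleftrightarrow> \<kappa>C u < \<kappa>C c" if "u \<in> C" "c \<in> C" for u c
    using lex[of u c] cl_C that in_V by simp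
  have less_T: "\<kappa> u < \<kappa> t \<longleftrightarrow> \<kappa>T j u < \<kappa>T j t" if "j \<in> {1..m}" "u \<in> Ts j" "t \<in> Ts j" for u t j
    using lex[of u t] cl_T[OF that(1,2)] cl_T[OF that(1,3)] in_V[of u j] in_V[of t j] that by simp
  have T_not_C: "t \<notin> C" "t \<in> verts H" if "j \<in> {1..m}" "t \<in> Ts j" for t j
  proof -
    have "t \<in> T" using that by (auto simp: T_def)
    then show "t \<notin> C" "t \<in> verts H" using partition(1,2) by auto
  qed
  have J_not_C: "u \<notin> C" "u \<in> verts H" if "k \<in> {1..n}" "u \<in> Js k" for u k
    using J_mem[OF that] partition(1,3) by auto

  have parent: "\<exists>p\<in>verts H. \<kappa> t < \<kappa> p \<and> adj H t p" if t: "j \<in> {1..m}" "t \<in> Ts j" for t j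
  proof (cases "t = root j")
    case True
    then show ?thesis
      using root[OF t(1)] below_C[OF T_not_C(2,1)[OF t]] in_V[of "anchor j"] by blast
  next
    case False
    then obtain p where "p \<in> Ts j" "\<kappa>T j t < \<kappa>T j p" "adj (induced H (Ts j)) t p"
      using \<kappa>T[OF t(1)] t(2) unfolding rooted_perfect_key_def by blast
    then show ?thesis
      using less_T[OF t] T_not_C[OF t(1)] by (auto simp: adj_induced)
  qed
  have parent_unique: "p = q"
    if t: "j \<in> {1..m}" "t \<in> Ts j" and p: "\<kappa> t < \<kappa> p" "adj H t p" and q: "\<kappa> t < \<kappa> q" "adj H t q"
    for t j p q
  proof (cases "t = root j")
    case True
    have "x = anchor j" if "\<kappa> t < \<kappa> x" "adj H t x" for x
    proof (rule ccontr)
      assume "x \<noteq> anchor j"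
      then have x: "x \<in> Ts j" "x \<noteq> root j"
        using tree_neighbour[OF t that(2)] that(1) True by auto
      then have "\<kappa>T j x < \<kappa>T j t"
        using \<kappa>T[OF t(1)] True by (simp add: rooted_perfect_key_def)
      then show False
        using less_T[OF t(1) x(1) t(2)] that(1) by simp
    qed
    then show ?thesis using p q by metis
  next
    case False
    then have pq: "p \<in> Ts j" "q \<in> Ts j"
      using tree_neighbour[OF t p(2)] tree_neighbour[OF t q(2)] by auto
    show ?thesis
    proof (rule ccontr)
      assume "p \<noteq> q"
      then have "adj (induced H (Ts j)) p q"
        using \<kappa>T[OF t(1)] t(2) pq p q less_T[OF t] unfolding rooted_perfect_key_def adj_induced
        by blast
      then show False
        using tree_no_triangle[OF t(1), of t p q] t(2) pq p q \<open>p \<noteq> q\<close>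
        by (auto simp: adj_induced adj_commute)
    qed
  qed

  have "\<exists>w\<in>verts H. \<kappa> v < \<kappa> w \<and> (\<forall>f\<in>F. adj H w f) \<and>
      (\<forall>u\<in>verts H. \<kappa> v \<le> \<kappa> u \<and> adj H v u \<longrightarrow> adj H w u)"
    if v: "v \<in> verts H" and F: "\<And>f. f \<in> F \<Longrightarrow> \<kappa> f < \<kappa> v" "\<And>f. f \<in> F \<Longrightarrow> adj H v f"
      and u: "u \<in> verts H" "\<kappa> v < \<kappa> u" "\<And>f. f \<in> F \<Longrightarrow> adj H u f" for v F u
    using v
  proof (cases rule: vertex_cases)
    case (J k)
    (* The hub has a loop, hence is its own neighbour. *)
    have hub_all: "adj H (hub k) x" if "adj H v x" for x
    proof -
      have "x \<in> Js k \<or> x = hub k" using hub_part_neighbour[OF J that] .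
      then show ?thesis
        using hub_iff[OF J(1), of x "hub k"] hub[OF J(1)] C_loop by (auto simp: adj_commute)
    qed
    have "\<kappa> v < \<kappa> (hub k)"
      using below_C[OF v J_not_C(1)[OF J] hub[OF J(1)]] .
    then show ?thesis
      using hub_all F(2) in_V[of "hub k"] hub[OF J(1)] by (intro bexI[of _ "hub k"]) auto
  next
    case (T j)
    have "F = {}"
    proof (rule ccontr)
      assume "F \<noteq> {}"
      then obtain f where f: "f \<in> F" by blast
      have "f \<noteq> anchor j"
        using below_C[OF v T_not_C(1)[OF T], of "anchor j"] root[OF T(1)] F(1)[OF f] by auto
      then have "f \<in> Ts j" using tree_neighbour[OF T F(2)[OF f]] by blast
      then have "v = u"
        using parent_unique[OF T(1), of f v u] F[OF f] u(2) u(3)[OF f]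
        by (simp add: adj_commute)
      then show False using u(2) by simp
    qed
    obtain p where p: "p \<in> verts H" "\<kappa> v < \<kappa> p" "adj H v p"
      using parent[OF T] by blast
    (* w is the parent of p. The anchor, as a looped vertex of C, serves as its own parent. *)
    obtain w where w: "w \<in> verts H" "\<kappa> p \<le> \<kappa> w" "adj H p w"
    proof (cases "p \<in> Ts j")
      case True
      then show ?thesis using parent[OF T(1) True] that by auto
    next
      case False
      then have "p \<in> C" using tree_neighbour[OF T p(3)] root[OF T(1)] by auto
      then show ?thesis using that[of p] p C_loop by simp
    qed
    have "adj H w x" if "x \<in> verts H" "\<kappa> v \<le> \<kappa> x" "adj H v x" for x
    proof -
      have "x \<noteq> v" using tree_no_loop[OF T] that by metis
      then have "\<kappa> v < \<kappa> x"
        using that v inj by (metis inj_onD le_neq_implies_less)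
      then have "x = p" using parent_unique[OF T] that p by blast
      then show ?thesis using w by (simp add: adj_commute)
    qed
    then show ?thesis
      using \<open>F = {}\<close> w p(2) by (intro bexI[of _ w]) auto
  next
    case C
    have above: "x \<in> C" if "x \<in> verts H" "\<kappa> v \<le> \<kappa> x" for x
      using below_C[OF that(1) _ C] that(2) by force
    have uC: "u \<in> C" using above u by simp
    have FC: "f \<in> C" if f: "f \<in> F" for f
    proof -
      have fv: "adj H f v" "adj H f u"
        using F(2)[OF f] u(3)[OF f] by (simp_all add: adj_commute)
      have "f \<in> verts H" using wf_ugraph_adj_verts(1)[OF wf fv(1)] .
      then show ?thesis
      proof (cases rule: vertex_cases)
        case (T j)
        then have "v = u" using root_unique[OF T] C uC fv by metis
        then show ?thesis using u(2) by simp
      next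
        case (J k)
        then have "v = u" using hub_iff[OF J] C uC fv by metis
        then show ?thesis using u(2) by simp
      qed
    qed
    have clique: "adj H a b"
      if "f \<in> C" "a \<in> C" "b \<in> C" "\<kappa> f < \<kappa> a" "\<kappa> f < \<kappa> b" "adj H f a" "adj H f b" for f a b
    proof (cases "a = b")
      case False
      have "adj CG f a" "adj CG f b"
        using that by (auto simp: adj_CG)
      then have "adj CG a b"
        using \<kappa>C that(1-5) less_C False unfolding rooted_perfect_key_def by blast
      then show ?thesis by (simp add: adj_CG)
    qed (use C_loop that in simp)
    (* Any later neighbour of v compatible with F will do, since the later neighbours of v form
       a clique. If F is empty, v is not the last vertex c0, because u is above it. *)
    obtain w where w: "w \<in> C" "\<kappa> v < \<kappa> w" "adj H v w" "\<And>f. f \<in> F \<Longrightarrow> adj H w f"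
    proof (cases "F = {}")
      case True
      have "v \<noteq> c0"
      proof
        assume "v = c0"
        then have "\<kappa>C u < \<kappa>C v"
          using \<kappa>C uC u(2) by (auto simp: rooted_perfect_key_def)
        then show False using less_C[OF uC C] u(2) by simp
      qed
      then obtain w where "w \<in> C" "\<kappa>C v < \<kappa>C w" "adj CG v w"
        using \<kappa>C C unfolding rooted_perfect_key_def by blast
      then show ?thesis
        using that[of w] True less_C[OF C] by (auto simp: adj_CG)
    next
      case False
      then obtain f where f: "f \<in> F" by blast
      have "adj H v u"
        using clique[OF FC[OF f] C uC] F[OF f] u(2) u(3)[OF f] by (simp add: adj_commute)
      then show ?thesis using that[of u] uC u by blast
    qed
    have "adj H w x" if "x \<in> verts H" "\<kappa> v \<le> \<kappa> x" "adj H v x" for x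
    proof (cases "x = v")
      case True
      then show ?thesis using w(3) by (simp add: adj_commute)
    next
      case False
      then have "\<kappa> v < \<kappa> x" using that v inj by (metis inj_onD le_neq_implies_less)
      then show ?thesis
        using clique[OF C w(1) above[OF that(1,2)] w(2) _ w(3) that(3)] by blast
    qed
    then show ?thesis
      using w in_V[of w] by (intro bexI[of _ w]) auto
  qed
  then have "elimination_key H \<kappa>"
    unfolding elimination_key_def using inj by blast
  then show ?thesis by blast
qed

end

lemma decomposition_of_decomposable:
  assumes "constraint_graph H" "connected_ugraph H" "chordal_tree_decomposable H"
  shows "\<exists>C m Ts root anchor n Js hub. chordal_tree_decomposition H C m Ts root anchor n Js hub"
proof -
  obtain C T J and m n :: nat and Ts Js where dec:
    "verts H = C \<union> T \<union> J" "C \<inter> T = {}" "C \<inter> J = {}" "T \<inter> J = {}"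
    "C \<noteq> {}" "loop_chordal (induced H C)"
    "T = (\<Union>j\<in>{1..m}. Ts j)" "disjoint_family_on Ts {1..m}"
    "\<forall>j\<in>{1..m}. is_tree (induced H (Ts j)) \<and>
       (\<exists>!(t, c). t \<in> Ts j \<and> c \<in> C \<and> {t, c} \<in> edges H)"
    "J = (\<Union>k\<in>{1..n}. Js k)" "disjoint_family_on Js {1..n}"
    "\<forall>k\<in>{1..n}. connected_ugraph (induced H (Js k)) \<and>
       (\<exists>!c. c \<in> C \<and> (\<forall>u\<in>Js k. \<forall>c'\<in>C. {u, c'} \<in> edges H \<longleftrightarrow> c' = c))"
    "edges_between H T J = {}"
    "\<forall>i\<in>{1..m}. \<forall>j\<in>{1..m}. i \<noteq> j \<longrightarrow> edges_between H (Ts i) (Ts j) = {}"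
    "\<forall>k\<in>{1..n}. \<forall>l\<in>{1..n}. k \<noteq> l \<longrightarrow> edges_between H (Js k) (Js l) = {}"
    using assms(3) unfolding chordal_tree_decomposable_def by (elim exE conjE) (rule that; assumption)
  have "\<forall>j\<in>{1..m}. \<exists>rc. fst rc \<in> Ts j \<and> snd rc \<in> C \<and> adj H (fst rc) (snd rc) \<and>
      (\<forall>t\<in>Ts j. \<forall>c\<in>C. adj H t c \<longrightarrow> t = fst rc \<and> c = snd rc)"
  proof
    fix j assume "j \<in> {1..m}"
    then have "\<exists>!x. case x of (t, c) \<Rightarrow> t \<in> Ts j \<and> c \<in> C \<and> {t, c} \<in> edges H"
      using dec(9) by blast
    then obtain x where x: "case x of (t, c) \<Rightarrow> t \<in> Ts j \<and> c \<in> C \<and> {t, c} \<in> edges H"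
      and unique: "\<And>y. case y of (t, c) \<Rightarrow> t \<in> Ts j \<and> c \<in> C \<and> {t, c} \<in> edges H \<Longrightarrow> y = x"
      by (elim ex1E) (rule that, assumption, erule allE, erule (1) mp)
    have "t = fst x \<and> c = snd x" if "t \<in> Ts j" "c \<in> C" "adj H t c" for t c
      using unique[of "(t, c)"] that by (auto simp: adj_def)
    then show "\<exists>rc. fst rc \<in> Ts j \<and> snd rc \<in> C \<and> adj H (fst rc) (snd rc) \<and>
        (\<forall>t\<in>Ts j. \<forall>c\<in>C. adj H t c \<longrightarrow> t = fst rc \<and> c = snd rc)"
      using x by (intro exI[of _ x]) (simp add: split_beta adj_def)
  qed
  from bchoice[OF this] obtain rc where rc: "\<forall>j\<in>{1..m}. fst (rc j) \<in> Ts j \<and> snd (rc j) \<in> C \<and>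
      adj H (fst (rc j)) (snd (rc j)) \<and>
      (\<forall>t\<in>Ts j. \<forall>c\<in>C. adj H t c \<longrightarrow> t = fst (rc j) \<and> c = snd (rc j))"
    by blast
  have "\<forall>k\<in>{1..n}. \<exists>c. c \<in> C \<and> (\<forall>u\<in>Js k. \<forall>c'\<in>C. adj H u c' \<longleftrightarrow> c' = c)"
    using dec(12) unfolding adj_def by blast
  from bchoice[OF this] obtain hub where
    hub: "\<forall>k\<in>{1..n}. hub k \<in> C \<and> (\<forall>u\<in>Js k. \<forall>c'\<in>C. adj H u c' \<longleftrightarrow> c' = hub k)"
    by blast
  have "chordal_tree_decomposition H C m Ts (fst \<circ> rc) (snd \<circ> rc) n Js hub"
  proof
    show "wf_ugraph H" "finite (verts H)"
      using assms(1) by (auto simp: constraint_graph_def)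
    show "t = (fst \<circ> rc) j \<and> c = (snd \<circ> rc) j"
      if "j \<in> {1..m}" "t \<in> Ts j" "c \<in> C" "adj H t c" for j t c
      using rc that by auto
    show "adj H u c \<longleftrightarrow> c = hub k" if "k \<in> {1..n}" "u \<in> Js k" "c \<in> C" for k u c
      using hub that by blast
    show "is_tree (induced H (Ts j))" if "j \<in> {1..m}" for j
      using dec(9) that by blast
    show "edges_between H (Ts i) (Ts j) = {}" if "i \<in> {1..m}" "j \<in> {1..m}" "i \<noteq> j" for i j
      using dec(14) that by blast
    show "edges_between H (Js k) (Js l) = {}" if "k \<in> {1..n}" "l \<in> {1..n}" "k \<noteq> l" for k l
      using dec(15) that by blast
    show "connected_ugraph H" "C \<noteq> {}" "loop_chordal (induced H C)"
      "disjoint_family_on Ts {1..m}" "disjoint_family_on Js {1..n}"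
      using assms(2) dec(5,6,8,11) by blast+
    show "verts H = C \<union> (\<Union>j\<in>{1..m}. Ts j) \<union> (\<Union>k\<in>{1..n}. Js k)"
      using dec(1) unfolding dec(7,10) .
    show "C \<inter> (\<Union>j\<in>{1..m}. Ts j) = {}" "C \<inter> (\<Union>k\<in>{1..n}. Js k) = {}"
      "(\<Union>j\<in>{1..m}. Ts j) \<inter> (\<Union>k\<in>{1..n}. Js k) = {}"
      using dec(2,3,4) unfolding dec(7,10) .
    show "edges_between H (\<Union>j\<in>{1..m}. Ts j) (\<Union>k\<in>{1..n}. Js k) = {}"
      using dec(13) unfolding dec(7,10) .
    show "(fst \<circ> rc) j \<in> Ts j \<and> (snd \<circ> rc) j \<in> C \<and> adj H ((fst \<circ> rc) j) ((snd \<circ> rc) j)"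
      if "j \<in> {1..m}" for j
      using rc that by simp
    show "hub k \<in> C" if "k \<in> {1..n}" for k
      using hub that by blast
  qed
  then show ?thesis by blast
qed

theorem theorem6p6:
  fixes G :: "'v ugraph" and H :: "'h ugraph"
  assumes "constraint_graph H"
    and "connected_ugraph H"
    and "chordal_tree_decomposable H"
    and "board G"
  shows "UMC G H (card (verts H) - 2)"
proof -
  obtain C m Ts root anchor n Js hub where
    "chordal_tree_decomposition H C m Ts root anchor n Js hub"
    using decomposition_of_decomposable[OF assms(1-3)] by blast
  then obtain \<kappa> where "elimination_key H \<kappa>"
    using chordal_tree_decomposition.elimination_key_exists by blast
  moreover have "wf_ugraph G" "loopless G" "finite (verts H)"
    using assms(1,4) by (auto simp: board_def constraint_graph_def)
  ultimately show ?thesis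
    by (rule UMC_if_elimination_key)
qed

end
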